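(* Let $U\subset D(0,T)$ be an open set and $E=\mathbb C\setminus U=U^c$. Let $\mu_1$ and $\mu_2$ be the measures given, with $r=|z|$, by $$d\mu_1(z)=\begin{cases}\frac1{4\pi}\big(g''(r)+\frac1r g'(r)\big)dm(z)& z\in D(0,T)\setminus U\\ 0&\text{otherwise}\end{cases},\qquad d\mu_2(z)=\begin{cases}\frac1{4\pi}\big(g''(r)+\frac1r g'(r)\big)dm(z)& z\in U\\ 0&\text{otherwise}\end{cases}$$ and let $\nu_2$ be the balayage measure on $\partial U$ with respect to $\mu_2$. Then the equilibrium measure for $U^c$ with the external field $\frac{g(|z|)}2$ is $\nu=\mu_1+\nu_2$, and $$R_U^{(g)}=R_\emptyset^{(g)}+\frac12\left[\int_{\partial U}g(|z|)\,d\nu_2(z)-\int_U g(|z|)\,d\mu_2(z)\right].$$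
   Context: $m$ is Lebesgue measure on $\mathbb C$, $D(0,t)$ the disk of radius $t$ centred at $0$, $\emptyset$ the empty set. The function $g:[0,\infty)\to[0,\infty)$ satisfies: (1) $g$ is increasing and $re^{-g(r)/2}\to0$ as $r\to\infty$; (2) $g$ is twice differentiable on $(0,\infty)$; (3) $\lim_{r\to0^+}rg'(r)=0$ and $rg'(r)$ is increasing on $(0,\infty)$. $T>0$ denotes the (unique) solution of $tg'(t)=2$. $\mathcal P(E)$ is the set of compactly supported probability measures with support in $E$. For $\mu\in\mathcal P(\mathbb C)$, $R_\mu^{(g)}=\iint\log\frac1{|z-w|}d\mu(z)d\mu(w)+\int g(|z|)d\mu(z)$, and $R_U^{(g)}=\inf\{R_\mu^{(g)}:\mu\in\mathcal P(U^c)\}$ (the minimum energy). The equilibrium measure for $E$ with external field $g(|z|)/2$ is the unique minimizer of $R_\mu^{(g)}$ over $\mu\in\mathcal P(E)$. Balayage: the potential of a finite compactly supported measure $\sigma$ is $p_\sigma(z)=-\int\log|z-w|d\sigma(w)$. A set is polar if $\int p_\sigma d\sigma=\infty$ for every compactly supported probability measure $\sigma$ with support in it; a property holds quasi-everywhere (q.e.) on a set if it holds there outside a Borel polar set. For a bounded open set $V$ and a finite Borel measure $\sigma$ on $V$, the balayage measure of $\sigma$ is the unique measure $\hat\sigma$ on $\partial V$ with $\hat\sigma(\partial V)=\sigma(V)$, $\hat\sigma(B)=0$ for every Borel polar set $B$, and $p_{\hat\sigma}=p_\sigma$ q.e. on $V^c$. *)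

theory Defs
  imports "HOL-Probability.Probability"
begin

text \<open>
  Only the values of \<^term>\<open>g\<close> on \<open>[0,\<infinity>)\<close> matter; \<^term>\<open>deriv g\<close> and \<^term>\<open>deriv (deriv g)\<close> are only
  used at points \<open>r > 0\<close>. ``Increasing'' is read as non-decreasing.
\<close>
definition external_field :: "(real \<Rightarrow> real) \<Rightarrow> bool" where
  "external_field g \<longleftrightarrow>
     (\<forall>r\<ge>0. 0 \<le> g r) \<and>
     mono_on {0..} g \<and> ((\<lambda>r. r * exp (- g r / 2)) \<longlongrightarrow> 0) at_top \<and>
     (\<forall>r>0. g differentiable (at r) \<and> deriv g differentiable (at r)) \<and>
     ((\<lambda>r. r * deriv g r) \<longlongrightarrow> 0) (at_right 0) \<and> mono_on {0<..} (\<lambda>r. r * deriv g r)"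

text \<open>
  Integral of an extended-real function as positive part minus negative part
  (\<^const>\<open>e2ennreal\<close> sends negative values to 0). For compactly supported finite measures all the
  integrands below are bounded below on the support, so the negative part is finite and the junk
  case \<open>\<infinity> - \<infinity>\<close> does not arise.
\<close>
definition eintegral :: "'a measure \<Rightarrow> ('a \<Rightarrow> ereal) \<Rightarrow> ereal" where
  "eintegral M f =
     enn2ereal (\<integral>\<^sup>+x. e2ennreal (f x) \<partial>M) - enn2ereal (\<integral>\<^sup>+x. e2ennreal (- f x) \<partial>M)"

text \<open>\<open>log (1 / |z - w|)\<close>; the diagonal needs a separate case because \<open>ln 0 = 0\<close> in HOL.\<close>
definition log_kernel :: "complex \<Rightarrow> complex \<Rightarrow> ereal" where
  "log_kernel z w = (if z = w then \<infinity> else ereal (- ln (cmod (z - w))))"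

definition potential :: "complex measure \<Rightarrow> complex \<Rightarrow> ereal" where
  "potential \<sigma> z = eintegral \<sigma> (log_kernel z)"

definition log_energy :: "complex measure \<Rightarrow> ereal" where
  "log_energy \<sigma> = eintegral \<sigma> (potential \<sigma>)"

definition msupport :: "complex measure \<Rightarrow> complex set" where
  "msupport \<mu> = {z. \<forall>V. open V \<longrightarrow> z \<in> V \<longrightarrow> emeasure \<mu> V > 0}"

definition compact_probs :: "complex set \<Rightarrow> complex measure set" where
  "compact_probs E =
     {\<mu>. prob_space \<mu> \<and> sets \<mu> = sets borel \<and> compact (msupport \<mu>) \<and> msupport \<mu> \<subseteq> E}"

definition weighted_energy :: "(real \<Rightarrow> real) \<Rightarrow> complex measure \<Rightarrow> ereal" where
  "weighted_energy g \<mu> = log_energy \<mu> + eintegral \<mu> (\<lambda>z. ereal (g (cmod z)))"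

definition min_energy :: "(real \<Rightarrow> real) \<Rightarrow> complex set \<Rightarrow> ereal" where
  "min_energy g U = (INF \<mu>\<in>compact_probs (- U). weighted_energy g \<mu>)"

text \<open>\<open>\<nu>\<close> is the one and only minimizer, for the external field \<open>g(|z|)/2\<close>.\<close>
definition is_equilibrium_measure ::
    "(real \<Rightarrow> real) \<Rightarrow> complex set \<Rightarrow> complex measure \<Rightarrow> bool" where
  "is_equilibrium_measure g E \<nu> \<longleftrightarrow>
     (\<forall>\<mu>. is_arg_min (weighted_energy g) (\<lambda>\<mu>. \<mu> \<in> compact_probs E) \<mu> \<longleftrightarrow> \<mu> = \<nu>)"

definition polar :: "complex set \<Rightarrow> bool" where
  "polar A \<longleftrightarrow> (\<forall>\<sigma>\<in>compact_probs A. log_energy \<sigma> = \<infinity>)"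

definition quasi_everywhere :: "complex set \<Rightarrow> (complex \<Rightarrow> bool) \<Rightarrow> bool" where
  "quasi_everywhere A P \<longleftrightarrow> (\<exists>N\<in>sets borel. polar N \<and> (\<forall>z\<in>A - N. P z))"

text \<open>
  \<open>\<tau>\<close> is the balayage of \<open>\<sigma>\<close>; meant for bounded open \<open>V\<close> and finite Borel \<open>\<sigma>\<close> carried by \<open>V\<close>.
  A measure on \<open>\<partial>V\<close> is encoded as a Borel measure on the plane that vanishes off \<open>\<partial>V\<close>.
\<close>
definition is_balayage :: "complex set \<Rightarrow> complex measure \<Rightarrow> complex measure \<Rightarrow> bool" where
  "is_balayage V \<sigma> \<tau> \<longleftrightarrow>
     sets \<tau> = sets borel \<and> emeasure \<tau> (- frontier V) = 0 \<and>
     emeasure \<tau> (frontier V) = emeasure \<sigma> V \<and>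
     (\<forall>B\<in>sets borel. polar B \<longrightarrow> emeasure \<tau> B = 0) \<and>
     quasi_everywhere (- V) (\<lambda>z. potential \<tau> z = potential \<sigma> z)"

definition field_measure :: "(real \<Rightarrow> real) \<Rightarrow> complex set \<Rightarrow> complex measure" where
  "field_measure g A = density lborel (\<lambda>z. if z \<in> A
     then ennreal (1 / (4 * pi) * (deriv (deriv g) (cmod z) + 1 / cmod z * deriv g (cmod z)))
     else 0)"

definition add_measure :: "'a measure \<Rightarrow> 'a measure \<Rightarrow> 'a measure" where
  "add_measure M N = measure_of (space M) (sets M) (\<lambda>A. emeasure M A + emeasure N A)"

lemma sets_add_measure [simp]: "sets (add_measure M N) = sets M"
  by (simp add: add_measure_def)

lemma emeasure_add_measure:
  assumes "sets N = sets M" and "A \<in> sets M"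
  shows "emeasure (add_measure M N) A = emeasure M A + emeasure N A"
  unfolding add_measure_def
proof (rule emeasure_measure_of_sigma)
  show "countably_additive (sets M) (\<lambda>A. emeasure M A + emeasure N A)"
  proof (rule countably_additiveI)
    fix F :: "nat \<Rightarrow> _" assume F: "range F \<subseteq> sets M" "disjoint_family F"
    then show "(\<Sum>i. emeasure M (F i) + emeasure N (F i)) =
        emeasure M (\<Union>i. F i) + emeasure N (\<Union>i. F i)"
      using assms(1) by (simp add: suminf_add[symmetric] suminf_emeasure)
  qed
qed (use assms(2) in \<open>auto simp: positive_def sets.sigma_algebra_axioms\<close>)

end

theory Submission
  imports
    Defs
    "HOL-Complex_Analysis.Cauchy_Integral_Formula"
    "HOL-Real_Asymp.Real_Asymp"
begin

text \<open>
  Write \<open>\<lambda>\<close> for the measure \<open>\<mu>\<^sub>1 + \<mu>\<^sub>2\<close> on the disc \<open>D(0,T)\<close> and \<open>F = g(T)/2 - log T\<close>. It is radial with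
  \<open>\<lambda>{|w| \<le> t} = t g'(t)/2\<close>, and the mean of \<open>log |z - w|\<close> over a circle \<open>|w| = r\<close> is \<open>log max(|z|, r)\<close>, so
  its potential satisfies \<open>p\<^sub>\<lambda> + g/2 = F\<close> on the punctured closed disc and \<open>p\<^sub>\<lambda> + g/2 \<ge> F\<close> elsewhere off 0
  (\<open>log_pot_lam_inside\<close>, \<open>log_pot_lam_ge\<close>). Sweeping \<open>\<mu>\<^sub>2\<close> out of \<open>U\<close> does not change potentials
  quasi-everywhere on \<open>- U\<close>, so the potential of \<open>\<nu> = \<mu>\<^sub>1 + \<nu>\<^sub>2\<close> agrees with \<open>p\<^sub>\<lambda>\<close> there.

  Measures of finite energy do not charge Borel polar sets (\<open>finite_energy_polar_null\<close>), hence exceptional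
  sets may be ignored when these relations are integrated. Integrating against \<open>\<nu>\<close> gives
  \<open>I(\<nu>) = F - (\<integral>g d\<nu>)/2\<close>, and for a competitor \<open>\<mu>\<close> of finite energy on \<open>- U\<close> the mutual energy satisfies
  \<open>I(\<mu>,\<nu>) \<ge> F - (\<integral>g d\<mu>)/2\<close>. Together with
  \<open>I(\<mu>) + I(\<nu>) = 2 I(\<mu>,\<nu>) + Q\<close>, where \<open>Q = I(\<mu> - \<nu>)\<close>, this yields
  \<open>R\<^sub>\<mu> \<ge> F + (\<integral>g d\<nu>)/2 + Q = R\<^sub>\<nu> + Q\<close>. So \<open>\<nu>\<close> is the unique minimizer as soon as \<open>Q > 0\<close> for
  \<open>\<mu> \<noteq> \<nu>\<close>, and the formula for the minimum energy follows by comparing with the case \<open>U = {}\<close>, where the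
  minimizer is \<open>\<lambda>\<close>.

  Strict positivity of \<open>Q\<close> is the analytic core. Frullani's integral represents \<open>log (M/|z - w|)\<close> as a mixture
  of the Gaussian kernels \<open>exp (- t |z - w|\<^sup>2)\<close>, up to a constant for each \<open>t\<close>. Each Gaussian kernel is a
  convolution square, so \<open>Q\<close> is an integral over \<open>t\<close> of squared \<open>L\<^sup>2\<close> distances between Gaussian smoothings of
  \<open>\<mu>\<close> and \<open>\<nu>\<close> (\<open>mutual_energy_parallelogram\<close>). If \<open>Q = 0\<close>, these smoothings agree for arbitrarily narrow
  Gaussians, which forces \<open>\<mu> = \<nu>\<close> (\<open>gauss_dist_eq_0_imp_eq\<close>).

  All energies are computed with the kernel \<open>log (M/|z - w|)\<close>, where \<open>M\<close> bounds the distances in the disc under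
  consideration. It is nonnegative, so that Tonelli's theorem applies without integrability conditions; the
  choice of \<open>M\<close> only changes energies of probability measures by the additive constant \<open>log M\<close>.
\<close>

section \<open>Logarithmic potentials with a nonnegative kernel\<close>

text \<open>
  The kernel \<open>log (M/|z - w|)\<close>. The conversion to \<^typ>\<open>ennreal\<close> truncates negative values to 0, so the formula
  is meant for \<open>|z - w| \<le> M\<close> only.
\<close>
definition log_ker :: "real \<Rightarrow> complex \<Rightarrow> complex \<Rightarrow> ennreal" where
  "log_ker M z w = (if z = w then \<infinity> else ennreal (ln (M / cmod (z - w))))"

text \<open>Potential of a measure with respect to the kernel \<^const>\<open>log_ker\<close>.\<close>
definition log_pot :: "real \<Rightarrow> complex measure \<Rightarrow> complex \<Rightarrow> ennreal" where
  "log_pot M \<sigma> z = (\<integral>\<^sup>+w. log_ker M z w \<partial>\<sigma>)"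

text \<open>Mutual energy \<open>\<integral>\<integral> log (M/|z - w|) d\<sigma>(z) d\<tau>(w)\<close>.\<close>
definition mutual_energy :: "real \<Rightarrow> complex measure \<Rightarrow> complex measure \<Rightarrow> ennreal" where
  "mutual_energy M \<sigma> \<tau> = (\<integral>\<^sup>+z. log_pot M \<tau> z \<partial>\<sigma>)"

text \<open>Finite Borel measures carried by the closed disc of radius \<open>R\<close> around 0.\<close>
definition disc_measure :: "real \<Rightarrow> complex measure \<Rightarrow> bool" where
  "disc_measure R \<sigma> \<longleftrightarrow> finite_measure \<sigma> \<and> sets \<sigma> = sets borel \<and> (AE z in \<sigma>. cmod z \<le> R)"

lemma disc_measureD:
  assumes "disc_measure R \<sigma>"
  shows "finite_measure \<sigma>" "sets \<sigma> = sets borel" "space \<sigma> = UNIV" "AE z in \<sigma>. cmod z \<le> R"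
    "sigma_finite_measure \<sigma>"
  using assms sets_eq_imp_space_eq[of \<sigma> borel] finite_measure.sigma_finite_measure
  by (auto simp: disc_measure_def finite_measure_def)

lemma log_ker_measurable [measurable]:
  "(\<lambda>p. log_ker M (fst p) (snd p)) \<in> borel_measurable (borel \<Otimes>\<^sub>M borel)"
proof -
  have eq: "log_ker M z w = (if cmod (z - w) = 0 then \<infinity> else ennreal (ln (M / cmod (z - w))))" for z w
    by (simp add: log_ker_def)
  show ?thesis unfolding eq by measurable
qed

lemma log_ker_measurable' [measurable (raw)]:
  assumes "f \<in> borel_measurable N" "h \<in> borel_measurable N"
  shows "(\<lambda>x. log_ker M (f x) (h x)) \<in> borel_measurable N"
  using measurable_compose[OF measurable_Pair[OF assms] log_ker_measurable[of M]] by simp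

lemma log_ker_commute: "log_ker M z w = log_ker M w z"
  by (simp add: log_ker_def norm_minus_commute)

lemma log_pot_measurable:
  assumes "disc_measure R \<sigma>"
  shows "log_pot M \<sigma> \<in> borel_measurable borel"
proof -
  interpret sigma_finite_measure \<sigma> using disc_measureD[OF assms] by simp
  note [measurable_cong] = disc_measureD(2)[OF assms]
  show ?thesis unfolding log_pot_def[abs_def] by measurable
qed

lemma eintegral_cong_AE:
  assumes "AE x in \<sigma>. f x = h x"
  shows "eintegral \<sigma> f = eintegral \<sigma> h"
proof -
  have "(\<integral>\<^sup>+x. e2ennreal (f x) \<partial>\<sigma>) = (\<integral>\<^sup>+x. e2ennreal (h x) \<partial>\<sigma>)"
    "(\<integral>\<^sup>+x. e2ennreal (- f x) \<partial>\<sigma>) = (\<integral>\<^sup>+x. e2ennreal (- h x) \<partial>\<sigma>)"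
    by (rule nn_integral_cong_AE; use assms in eventually_elim; simp)+
  then show ?thesis by (simp add: eintegral_def)
qed

text \<open>
  Subtracting a constant from a nonnegative function on a finite measure space. This is the bridge between the
  signed integrals of potentials and energies and the nonnegative ones used here.
\<close>
lemma eintegral_shift:
  assumes "finite_measure \<sigma>" and f [measurable]: "f \<in> borel_measurable \<sigma>" and "c \<ge> 0"
  shows "eintegral \<sigma> (\<lambda>x. enn2ereal (f x) - ereal c) =
    enn2ereal (\<integral>\<^sup>+x. f x \<partial>\<sigma>) - ereal (c * measure \<sigma> (space \<sigma>))"
proof -
  interpret finite_measure \<sigma> by fact
  define p where "p x = e2ennreal (enn2ereal (f x) - ereal c)" for x
  define n where "n x = e2ennreal (- (enn2ereal (f x) - ereal c))" for x
  have [measurable]: "p \<in> borel_measurable \<sigma>" "n \<in> borel_measurable \<sigma>"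
    unfolding p_def n_def by measurable
  have pn: "p x + ennreal c = f x + n x" for x
  proof (cases "f x")
    case (real r)
    then show ?thesis using \<open>c \<ge> 0\<close>
      apply (simp add: p_def n_def e2ennreal_ereal enn2ereal_ennreal)
      apply (cases "r \<ge> c")
       apply (simp_all add: ennreal_plus[symmetric] ennreal_neg del: ennreal_plus)
      done
  next
    case top
    then show ?thesis by (simp add: p_def n_def e2ennreal_infty)
  qed
  have n_le: "n x \<le> ennreal c" for x
  proof (cases "f x")
    case (real r)
    then show ?thesis using \<open>c \<ge> 0\<close>
      by (simp add: n_def e2ennreal_ereal enn2ereal_ennreal ennreal_leI)
  next
    case top
    then show ?thesis by (simp add: n_def e2ennreal_neg)
  qed
  have "(\<integral>\<^sup>+x. n x \<partial>\<sigma>) \<le> (\<integral>\<^sup>+x. ennreal c \<partial>\<sigma>)"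
    by (intro nn_integral_mono n_le)
  also have c: "(\<integral>\<^sup>+x. ennreal c \<partial>\<sigma>) = ennreal (c * measure \<sigma> (space \<sigma>))"
    using \<open>c \<ge> 0\<close> by (simp add: emeasure_eq_measure ennreal_mult)
  finally have fin: "(\<integral>\<^sup>+x. n x \<partial>\<sigma>) < \<infinity>"
    by (simp add: less_top order_le_less_trans)
  have "(\<integral>\<^sup>+x. p x \<partial>\<sigma>) + (\<integral>\<^sup>+x. ennreal c \<partial>\<sigma>) = (\<integral>\<^sup>+x. f x \<partial>\<sigma>) + (\<integral>\<^sup>+x. n x \<partial>\<sigma>)"
    by (simp add: nn_integral_add[symmetric] pn del: nn_integral_const)
  then have sum: "(\<integral>\<^sup>+x. p x \<partial>\<sigma>) + ennreal (c * measure \<sigma> (space \<sigma>)) = (\<integral>\<^sup>+x. f x \<partial>\<sigma>) + (\<integral>\<^sup>+x. n x \<partial>\<sigma>)"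
    unfolding c .
  have "enn2ereal P - enn2ereal N = enn2ereal F - ereal C"
    if "P + ennreal C = F + N" "N < \<infinity>" "C \<ge> 0" for P N F C
    using that
    apply (cases P; cases N; cases F)
           apply (auto simp: ennreal_plus[symmetric] enn2ereal_ennreal simp del: ennreal_plus)
    done
  from this[OF sum fin] \<open>c \<ge> 0\<close> show ?thesis
    by (simp add: eintegral_def p_def n_def)
qed

lemma log_kernel_eq:
  assumes "cmod z \<le> R" "cmod w \<le> R" "2 * R \<le> M" "1 \<le> M"
  shows "log_kernel z w = enn2ereal (log_ker M z w) - ereal (ln M)"
proof (cases "z = w")
  case True
  then show ?thesis by (simp add: log_kernel_def log_ker_def)
next
  case False
  have "cmod (z - w) \<le> M"
    using norm_triangle_ineq4[of z w] assms by linarith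
  moreover have "cmod (z - w) > 0" using False by simp
  ultimately have "ln (M / cmod (z - w)) \<ge> 0" using assms by simp
  then show ?thesis using False \<open>cmod (z - w) > 0\<close> assms
    by (simp add: log_kernel_def log_ker_def enn2ereal_ennreal ln_div)
qed

lemma potential_eq:
  assumes \<sigma>: "disc_measure R \<sigma>" and M: "2 * R \<le> M" "1 \<le> M" and z: "cmod z \<le> R"
  shows "potential \<sigma> z = enn2ereal (log_pot M \<sigma> z) - ereal (ln M * measure \<sigma> UNIV)"
proof -
  note [measurable_cong] = disc_measureD(2)[OF \<sigma>]
  have "potential \<sigma> z = eintegral \<sigma> (\<lambda>w. enn2ereal (log_ker M z w) - ereal (ln M))"
    unfolding potential_def
    using disc_measureD(4)[OF \<sigma>] log_kernel_eq[OF z _ M]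
    by (intro eintegral_cong_AE) (auto elim: eventually_mono)
  also have "\<dots> = enn2ereal (log_pot M \<sigma> z) - ereal (ln M * measure \<sigma> UNIV)"
    using M disc_measureD[OF \<sigma>] by (subst eintegral_shift) (auto simp: log_pot_def)
  finally show ?thesis .
qed

lemma log_energy_eq:
  assumes \<sigma>: "disc_measure R \<sigma>" and M: "2 * R \<le> M" "1 \<le> M"
  shows "log_energy \<sigma> = enn2ereal (mutual_energy M \<sigma> \<sigma>) - ereal (ln M * (measure \<sigma> UNIV)\<^sup>2)"
proof -
  note [measurable_cong] = disc_measureD(2)[OF \<sigma>]
  note [measurable] = log_pot_measurable[OF \<sigma>]
  have "log_energy \<sigma> = eintegral \<sigma> (\<lambda>z. enn2ereal (log_pot M \<sigma> z) - ereal (ln M * measure \<sigma> UNIV))"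
    unfolding log_energy_def
    using disc_measureD(4)[OF \<sigma>] potential_eq[OF \<sigma> M]
    by (intro eintegral_cong_AE) (auto elim: eventually_mono)
  also have "\<dots> = enn2ereal (mutual_energy M \<sigma> \<sigma>) - ereal (ln M * (measure \<sigma> UNIV)\<^sup>2)"
    using M disc_measureD[OF \<sigma>]
    by (subst eintegral_shift) (auto simp: mutual_energy_def power2_eq_square mult_ac)
  finally show ?thesis .
qed

lemma closed_msupport: "closed (msupport \<mu>)"
proof -
  have "- msupport \<mu> = \<Union>{V. open V \<and> emeasure \<mu> V = 0}"
    by (auto simp: msupport_def zero_less_iff_neq_zero)
  then show ?thesis by (metis (no_types, lifting) closed_def mem_Collect_eq open_Union)
qed

text \<open>A Borel measure on the plane is carried by its support, by the Lindeloef property of the plane.\<close>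
lemma emeasure_compl_msupport:
  assumes "sets \<mu> = sets borel"
  shows "emeasure \<mu> (- msupport \<mu>) = 0"
proof -
  define F where "F = {V. open V \<and> emeasure \<mu> V = 0}"
  have eq: "- msupport \<mu> = \<Union>F"
    by (auto simp: msupport_def F_def zero_less_iff_neq_zero)
  obtain F' where F': "F' \<subseteq> F" "countable F'" "\<Union>F' = \<Union>F"
    using Lindelof[of F] by (auto simp: F_def)
  have "(\<Union>V\<in>F'. V) \<in> null_sets \<mu>"
    using F'(1,2) assms by (intro null_sets_UN') (auto simp: F_def null_sets_def)
  then show ?thesis using eq F' by (simp add: null_sets_def)
qed

lemma msupport_subset_closed:
  assumes "closed K" "emeasure \<mu> (- K) = 0"
  shows "msupport \<mu> \<subseteq> K"
  using assms by (force simp: msupport_def closed_def)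

text \<open>
  Otherwise, by inner regularity, the polar set contains a compact set \<open>K\<close> of positive measure. The normalized
  restriction of \<open>\<sigma>\<close> to \<open>K\<close> has energy at most \<open>I(\<sigma>)/\<sigma>(K)\<^sup>2\<close>, which is finite, contradicting polarity.
\<close>
lemma finite_energy_polar_null:
  assumes \<sigma>: "disc_measure R \<sigma>" and M: "2 * R \<le> M" "1 \<le> M"
    and fin: "mutual_energy M \<sigma> \<sigma> < \<infinity>" and N: "N \<in> sets borel" "polar N"
  shows "emeasure \<sigma> N = 0"
proof (rule ccontr)
  assume "emeasure \<sigma> N \<noteq> 0"
  note D = disc_measureD[OF \<sigma>]
  note [measurable_cong] = D(2)
  note [measurable] = log_pot_measurable[OF \<sigma>]
  interpret finite_measure \<sigma> by (rule D)
  have "emeasure \<sigma> N = (SUP K \<in> {K. K \<subseteq> N \<and> compact K}. emeasure \<sigma> K)"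
    using N by (intro inner_regular) (auto simp: D)
  with \<open>emeasure \<sigma> N \<noteq> 0\<close> obtain K where K: "K \<subseteq> N" "compact K" "emeasure \<sigma> K \<noteq> 0"
    by (metis (mono_tags, lifting) SUP_bot_conv(2) bot_ennreal mem_Collect_eq)
  have [measurable]: "K \<in> sets borel" using K by (simp add: borel_compact)
  define c where "c = measure \<sigma> K"
  have c: "c > 0" "emeasure \<sigma> K = ennreal c"
    using K by (auto simp: c_def emeasure_eq_measure zero_less_measure_iff)
  define \<tau> where "\<tau> = density \<sigma> (\<lambda>x. indicator K x / ennreal c)"
  have \<tau>_eq: "\<tau> = uniform_measure \<sigma> K" by (simp add: \<tau>_def uniform_measure_def c)
  interpret \<tau>: prob_space \<tau>
    unfolding \<tau>_eq using K by (intro prob_space_uniform_measure) auto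
  have sets\<tau>: "sets \<tau> = sets borel" by (simp add: \<tau>_def D)
  have null: "emeasure \<tau> (- K) = 0"
    unfolding \<tau>_eq using K D by (subst emeasure_uniform_measure) auto
  have supp: "msupport \<tau> \<subseteq> K"
    using null K by (intro msupport_subset_closed) (auto simp: compact_imp_closed)
  have "compact (msupport \<tau>)"
    using compact_Int_closed[OF K(2) closed_msupport[of \<tau>]] supp by (simp add: Int_absorb1)
  then have "\<tau> \<in> compact_probs N"
    using supp K(1) sets\<tau> \<tau>.prob_space_axioms by (auto simp: compact_probs_def)
  then have inf: "log_energy \<tau> = \<infinity>" using N by (auto simp: polar_def)
  have "AE z in \<tau>. cmod z \<le> R"
    unfolding \<tau>_def using D(4) by (subst AE_density) (auto elim: eventually_mono)
  then have "disc_measure R \<tau>"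
    using sets\<tau> \<tau>.finite_measure_axioms by (simp add: disc_measure_def)
  from log_energy_eq[OF this M] inf have "mutual_energy M \<tau> \<tau> = \<infinity>"
    by (cases "mutual_energy M \<tau> \<tau>") (auto simp: enn2ereal_ennreal)
  moreover have "mutual_energy M \<tau> \<tau> \<le> mutual_energy M \<sigma> \<sigma> * ennreal (1/c) * ennreal (1/c)"
  proof -
    have le: "(\<integral>\<^sup>+x. f x \<partial>\<tau>) \<le> (\<integral>\<^sup>+x. f x \<partial>\<sigma>) * ennreal (1/c)" if [measurable]: "f \<in> borel_measurable borel" for f
    proof -
      have "(\<integral>\<^sup>+x. f x \<partial>\<tau>) = (\<integral>\<^sup>+x. indicator K x / ennreal c * f x \<partial>\<sigma>)"
        unfolding \<tau>_def by (subst nn_integral_density) auto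
      also have "\<dots> \<le> (\<integral>\<^sup>+x. f x * ennreal (1/c) \<partial>\<sigma>)"
        using c by (intro nn_integral_mono)
          (auto simp: indicator_def divide_ennreal_def inverse_ennreal mult_ac inverse_eq_divide)
      also have "\<dots> = (\<integral>\<^sup>+x. f x \<partial>\<sigma>) * ennreal (1/c)"
        by (simp add: nn_integral_multc)
      finally show ?thesis .
    qed
    have "log_pot M \<tau> z \<le> log_pot M \<sigma> z * ennreal (1/c)" for z
      unfolding log_pot_def by (rule le) measurable
    then have "mutual_energy M \<tau> \<tau> \<le> (\<integral>\<^sup>+z. log_pot M \<sigma> z * ennreal (1/c) \<partial>\<tau>)"
      unfolding mutual_energy_def by (intro nn_integral_mono)
    also have "\<dots> \<le> (\<integral>\<^sup>+z. log_pot M \<sigma> z * ennreal (1/c) \<partial>\<sigma>) * ennreal (1/c)"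
      by (intro le) measurable
    also have "\<dots> = mutual_energy M \<sigma> \<sigma> * ennreal (1/c) * ennreal (1/c)"
      unfolding mutual_energy_def by (subst nn_integral_multc) auto
    finally show ?thesis .
  qed
  ultimately show False using fin by (auto simp: ennreal_mult_eq_top_iff top_unique)
qed

text \<open>The only probability measure carried by a point is the Dirac measure, whose energy is infinite.\<close>
lemma polar_singleton: "polar {a}"
proof -
  have "log_energy \<sigma> = \<infinity>" if "\<sigma> \<in> compact_probs {a}" for \<sigma>
  proof -
    from that have *: "prob_space \<sigma>" "sets \<sigma> = sets borel" "msupport \<sigma> \<subseteq> {a}"
      by (auto simp: compact_probs_def)
    interpret prob_space \<sigma> by fact
    have "emeasure \<sigma> (- {a}) = 0"
    proof -
      have "emeasure \<sigma> (- {a}) \<le> emeasure \<sigma> (- msupport \<sigma>)"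
        using * closed_msupport[of \<sigma>] by (intro emeasure_mono) auto
      with emeasure_compl_msupport[of \<sigma>] * show ?thesis by simp
    qed
    moreover have sp: "space \<sigma> = UNIV" using sets_eq_imp_space_eq[OF *(2)] by simp
    ultimately have ae: "AE z in \<sigma>. z = a"
      using *(2) AE_iff_null[of \<sigma> "\<lambda>z. z = a"]
      by (simp add: null_sets_def Compl_eq)
    define R where "R = cmod a + 1"
    have dm: "disc_measure R \<sigma>"
      using ae by (auto simp: disc_measure_def R_def * finite_measure_axioms elim: eventually_mono)
    have "log_pot (2 * R) \<sigma> a = (\<integral>\<^sup>+w. \<infinity> \<partial>\<sigma>)"
      unfolding log_pot_def by (rule nn_integral_cong_AE) (use ae in eventually_elim, simp add: log_ker_def)
    also have "\<dots> = \<infinity>" using emeasure_space_1 by simp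
    finally have "mutual_energy (2 * R) \<sigma> \<sigma> = (\<integral>\<^sup>+w. \<infinity> \<partial>\<sigma>)"
      unfolding mutual_energy_def by (intro nn_integral_cong_AE) (use ae in eventually_elim, simp)
    also have "\<dots> = \<infinity>" using emeasure_space_1 by simp
    finally show ?thesis using log_energy_eq[OF dm, of "2 * R"] by (simp add: R_def)
  qed
  then show ?thesis by (simp add: polar_def)
qed

section \<open>Radial integrals and logarithmic means over circles\<close>

text \<open>Polar coordinates for radial integrands: both sides give the area of the disc of radius \<open>x\<close> to \<open>{..x}\<close>.\<close>
lemma distr_lborel_cmod:
  "distr lborel borel cmod = density lborel (\<lambda>r. ennreal (2 * pi * r * indicator {0..} r))"
proof (rule measure_eqI_generator_eq)
  let ?N = "density lborel (\<lambda>r. ennreal (2 * pi * r * indicator {0..} r))"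
  let ?E = "range (\<lambda>x::real. {..x})"
  show "Int_stable ?E" by (auto simp: Int_stable_def)
  show "sets (distr lborel borel cmod) = sigma_sets UNIV ?E" "sets ?N = sigma_sets UNIV ?E"
    by (simp_all add: borel_eq_atMost)
  show "range (\<lambda>i. {..real i}) \<subseteq> ?E" by auto
  show "(\<Union>i. {..real i}) = UNIV" using real_arch_simple by auto
  have M: "emeasure (distr lborel borel cmod) {..x} = (if x < 0 then 0 else ennreal (pi * x\<^sup>2))" for x
  proof -
    have "emeasure (distr lborel borel cmod) {..x} = emeasure lborel (cball (0::complex) x)"
      by (subst emeasure_distr) (auto simp: cball_def dist_norm intro!: arg_cong[where f="emeasure lborel"])
    then show ?thesis by (auto simp: emeasure_cball unit_ball_vol_2 cball_empty)
  qed
  show "emeasure (distr lborel borel cmod) {..real i} \<noteq> \<infinity>" for i by (simp add: M)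
  fix X :: "real set" assume "X \<in> ?E"
  then obtain x where X: "X = {..x}" by auto
  have "emeasure ?N {..x} = (if x < 0 then 0 else ennreal (pi * x\<^sup>2))"
  proof (cases "x < 0")
    case True
    then have "(\<lambda>r. ennreal (2 * pi * r * indicator {0..} r) * indicator {..x} r) = (\<lambda>r. 0)"
      by (auto simp: indicator_def fun_eq_iff)
    then show ?thesis using True
      by (subst emeasure_density) simp_all
  next
    case False
    have "emeasure ?N {..x} = (\<integral>\<^sup>+r. ennreal (2 * pi * r) * indicator {0..x} r \<partial>lborel)"
      by (subst emeasure_density) (auto intro!: nn_integral_cong simp: indicator_def)
    also have "\<dots> = ennreal (pi * x\<^sup>2 - pi * 0\<^sup>2)"
      using False by (intro nn_integral_FTC_Icc) (auto intro!: derivative_eq_intros)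
    finally show ?thesis using False by simp
  qed
  with M show "emeasure (distr lborel borel cmod) X = emeasure ?N X" by (simp add: X)
qed auto

lemma nn_integral_radial:
  fixes f :: "real \<Rightarrow> ennreal"
  assumes [measurable]: "f \<in> borel_measurable borel"
  shows "(\<integral>\<^sup>+z. f (cmod z) \<partial>lborel) = (\<integral>\<^sup>+r. ennreal (2 * pi * r * indicator {0..} r) * f r \<partial>lborel)"
proof -
  have "(\<integral>\<^sup>+z. f (cmod z) \<partial>lborel) = (\<integral>\<^sup>+r. f r \<partial>distr lborel borel cmod)"
    by (simp add: nn_integral_distr)
  also have "\<dots> = (\<integral>\<^sup>+r. ennreal (2 * pi * r * indicator {0..} r) * f r \<partial>lborel)"
    unfolding distr_lborel_cmod by (simp add: nn_integral_density)
  finally show ?thesis .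
qed

lemma nn_integral_lborel_translate:
  fixes f :: "complex \<Rightarrow> ennreal"
  assumes [measurable]: "f \<in> borel_measurable borel"
  shows "(\<integral>\<^sup>+x. f (y + x) \<partial>lborel) = (\<integral>\<^sup>+x. f x \<partial>lborel)"
  by (subst (2) lborel_distr_plus[symmetric, of y]) (simp add: nn_integral_distr)

text \<open>
  Uniqueness of translation-invariant measures, in the form of Weil's argument: the image \<open>\<rho>\<close> of Lebesgue measure
  under the rotation is translation-invariant and gives the unit disc \<open>B\<close> its area, and Tonelli's theorem yields
  \<open>\<rho>(A) m(B) = m(A) \<rho>(B)\<close>.
\<close>
lemma distr_lborel_rotation:
  fixes c :: complex
  assumes "cmod c = 1"
  shows "distr lborel borel ((*) c) = lborel"
proof (rule measure_eqI)
  define \<rho> where "\<rho> = distr lborel borel ((*) c)"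
  have [measurable]: "(*) c \<in> borel_measurable borel" by simp
  have [simp]: "sets \<rho> = sets borel" "space \<rho> = UNIV" by (auto simp: \<rho>_def)
  note [measurable_cong] = \<open>sets \<rho> = sets borel\<close>
  have c0: "c \<noteq> 0" using assms by auto
  have nn\<rho>: "(\<integral>\<^sup>+x. f x \<partial>\<rho>) = (\<integral>\<^sup>+x. f (c * x) \<partial>lborel)" if "f \<in> borel_measurable borel" for f
    using that unfolding \<rho>_def by (subst nn_integral_distr) auto
  have trans\<rho>: "(\<integral>\<^sup>+x. f (y + x) \<partial>\<rho>) = (\<integral>\<^sup>+x. f x \<partial>\<rho>)"
    if [measurable]: "f \<in> borel_measurable borel" for f y
  proof -
    have "(\<integral>\<^sup>+x. f (y + x) \<partial>\<rho>) = (\<integral>\<^sup>+x. f (c * (y / c + x)) \<partial>lborel)"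
      using c0 by (subst nn\<rho>) (auto simp: distrib_left)
    also have "\<dots> = (\<integral>\<^sup>+x. f (c * x) \<partial>lborel)"
      by (subst nn_integral_lborel_translate[of "\<lambda>x. f (c * x)"]) auto
    finally show ?thesis by (simp add: nn\<rho>)
  qed
  have ball: "emeasure \<rho> (ball 0 1) = emeasure lborel (ball (0::complex) 1)"
  proof -
    have "(*) c -` ball 0 1 = ball 0 1" using assms by (auto simp: norm_mult)
    then show ?thesis unfolding \<rho>_def by (subst emeasure_distr) auto
  qed
  have B: "emeasure lborel (ball (0::complex) 1) \<noteq> 0" "emeasure lborel (ball (0::complex) 1) \<noteq> \<infinity>"
    by (auto simp: emeasure_ball unit_ball_vol_2)
  interpret \<rho>: sigma_finite_measure \<rho>
  proof
    let ?A = "range (\<lambda>n. cball (0::complex) (real n))"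
    have "emeasure \<rho> (cball 0 (real n)) \<noteq> \<infinity>" for n
    proof -
      have "(*) c -` cball 0 (real n) = cball 0 (real n)" using assms by (auto simp: norm_mult)
      then show ?thesis unfolding \<rho>_def by (subst emeasure_distr) (auto simp: emeasure_cball)
    qed
    moreover have "\<Union>?A = space \<rho>" using real_arch_simple by (auto simp: dist_norm)
    ultimately show "\<exists>A. countable A \<and> A \<subseteq> sets \<rho> \<and> \<Union>A = space \<rho> \<and> (\<forall>a\<in>A. emeasure \<rho> a \<noteq> \<infinity>)"
      by (intro exI[of _ ?A]) auto
  qed
  interpret pair_sigma_finite \<rho> "lborel :: complex measure" ..
  fix A assume "A \<in> sets (distr lborel borel ((*) c))"
  then have [measurable]: "A \<in> sets borel" by simp
  let ?B = "ball (0::complex) 1"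
  have [measurable]: "?B \<in> sets borel" by simp
  have "emeasure \<rho> A * emeasure lborel ?B = (\<integral>\<^sup>+x. indicator A x * (\<integral>\<^sup>+y. indicator ?B y \<partial>lborel) \<partial>\<rho>)"
    by (simp add: nn_integral_multc)
  also have "\<dots> = (\<integral>\<^sup>+x. (\<integral>\<^sup>+y. indicator A x * indicator ?B (- x + y) \<partial>lborel) \<partial>\<rho>)"
  proof (rule nn_integral_cong)
    fix x
    have [measurable]: "(\<lambda>y. indicator ?B (- x + y) :: ennreal) \<in> borel_measurable borel"
      by (rule measurable_compose[of "\<lambda>y. - x + y" _ borel]) measurable
    have "(\<integral>\<^sup>+y. indicator A x * indicator ?B (- x + y) \<partial>lborel) =
        indicator A x * (\<integral>\<^sup>+y. indicator ?B (- x + y) \<partial>lborel)"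
      by (rule nn_integral_cmult) measurable
    also have "(\<integral>\<^sup>+y. indicator ?B (- x + y) \<partial>lborel) = (\<integral>\<^sup>+y. indicator ?B y \<partial>lborel)"
      by (rule nn_integral_lborel_translate) measurable
    finally show "indicator A x * (\<integral>\<^sup>+y. indicator ?B y \<partial>lborel) =
        (\<integral>\<^sup>+y. indicator A x * indicator ?B (- x + y) \<partial>lborel)" ..
  qed
  also have "\<dots> = (\<integral>\<^sup>+y. (\<integral>\<^sup>+x. indicator A x * indicator ?B (- x + y) \<partial>\<rho>) \<partial>lborel)"
    by (rule Fubini'[symmetric]) measurable
  also have "\<dots> = (\<integral>\<^sup>+y. (\<integral>\<^sup>+x. indicator A (y + x) * indicator ?B (- (y + x) + y) \<partial>\<rho>) \<partial>lborel)"
    by (subst trans\<rho>[where f="\<lambda>x. indicator A x * indicator ?B (- x + _)"]) auto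
  also have "\<dots> = (\<integral>\<^sup>+y. (\<integral>\<^sup>+x. indicator A (x + y) * indicator ?B x \<partial>\<rho>) \<partial>lborel)"
    by (simp add: add.commute indicator_def)
  also have "\<dots> = (\<integral>\<^sup>+x. (\<integral>\<^sup>+y. indicator A (x + y) * indicator ?B x \<partial>lborel) \<partial>\<rho>)"
    by (rule Fubini') measurable
  also have "\<dots> = (\<integral>\<^sup>+x. (\<integral>\<^sup>+y. indicator A y \<partial>lborel) * indicator ?B x \<partial>\<rho>)"
    by (intro nn_integral_cong) (simp add: nn_integral_multc nn_integral_lborel_translate[of "indicator A"] del: nn_integral_indicator)
  also have "\<dots> = emeasure lborel A * emeasure \<rho> ?B"
    by (simp add: nn_integral_cmult)
  finally have "emeasure \<rho> A = emeasure lborel A"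
    using B unfolding ball by (metis ennreal_mult_divide_eq infinity_ennreal_def)
  then show "emeasure (distr lborel borel ((*) c)) A = emeasure lborel A" by (simp add: \<rho>_def)
qed simp

text \<open>
  Mean value property, at the centre of the unit disc, of the harmonic function \<open>log |1 - u q|\<close>, which is the real
  part of a holomorphic function of \<open>u\<close> since \<open>|u q| < 1\<close>.
\<close>
lemma integral_ln_norm_circle:
  fixes q :: complex
  assumes "cmod q < 1"
  shows "((\<lambda>t. ln (cmod (1 - exp (2 * of_real pi * \<i> * of_real t) * q))) has_integral 0) {0..1}"
proof -
  have ne: "1 - u * q \<notin> \<real>\<^sub>\<le>\<^sub>0" if "cmod u \<le> 1" for u
  proof -
    have "cmod (u * q) < 1" using that assms
      by (metis mult_left_le_one_le norm_ge_zero norm_mult order_le_less_trans)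
    then have "Re (u * q) < 1" using complex_Re_le_cmod[of "u * q"] by linarith
    then show ?thesis by (auto simp: complex_nonpos_Reals_iff)
  qed
  have "(\<lambda>u. Ln (1 - u * q)) holomorphic_on cball 0 1"
    using ne by (intro holomorphic_intros) auto
  then have "((\<lambda>u. Ln (1 - u * q) / (u - 0)) has_contour_integral (2 * of_real pi * \<i> * Ln (1 - 0 * q))) (circlepath 0 1)"
    by (rule Cauchy_integral_circlepath_simple) simp
  then have "((\<lambda>t. Ln (1 - circlepath 0 1 t * q) / (circlepath 0 1 t - 0) *
      vector_derivative (circlepath 0 1) (at t within {0..1})) has_integral 0) {0..1}"
    by (simp add: has_contour_integral_def)
  then have "((\<lambda>t. 2 * of_real pi * \<i> * Ln (1 - exp (2 * of_real pi * \<i> * of_real t) * q)) has_integral 0) {0..1}"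
  proof (rule has_integral_eq[rotated])
    fix t :: real assume "t \<in> {0..1}"
    then have "vector_derivative (circlepath 0 1) (at t within {0..1}) =
        2 * of_real pi * \<i> * exp (2 * of_real pi * \<i> * of_real t)"
      by (simp add: vector_derivative_circlepath01)
    moreover have "circlepath 0 1 t = exp (2 * of_real pi * \<i> * of_real t)"
      by (simp add: circlepath)
    ultimately show "Ln (1 - circlepath 0 1 t * q) / (circlepath 0 1 t - 0) *
        vector_derivative (circlepath 0 1) (at t within {0..1}) =
        2 * of_real pi * \<i> * Ln (1 - exp (2 * of_real pi * \<i> * of_real t) * q)"
      by simp
  qed
  from has_integral_mult_right[OF this, of "1 / (2 * of_real pi * \<i>)"]
  have "((\<lambda>t. Ln (1 - exp (2 * of_real pi * \<i> * of_real t) * q)) has_integral 0) {0..1}"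
    by simp
  from has_integral_Re[OF this]
  have "((\<lambda>t. Re (Ln (1 - exp (2 * of_real pi * \<i> * of_real t) * q))) has_integral 0) {0..1}" by simp
  moreover have "1 - exp (2 * of_real pi * \<i> * of_real t) * q \<noteq> 0" for t :: real
    using ne[of "exp (2 * of_real pi * \<i> * of_real t)"] by force
  ultimately show ?thesis by simp
qed

text \<open>
  If \<open>|z| < |w|\<close>, the factor \<open>exp (2 \<pi> \<i> t)\<close> is moved from \<open>w\<close> to the conjugate of \<open>z/w\<close>, which reduces the claim
  to the previous lemma.
\<close>
lemma integral_ln_dist_circle:
  fixes z w :: complex
  assumes "cmod z \<noteq> cmod w"
  shows "((\<lambda>t. ln (cmod (z - exp (2 * of_real pi * \<i> * of_real t) * w))) has_integral ln (max (cmod z) (cmod w))) {0..1}"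
proof -
  let ?e = "\<lambda>t::real. exp (2 * of_real pi * \<i> * of_real t)"
  have ne: "1 - ?e t * q \<noteq> 0" if "cmod q < 1" for t q
  proof
    assume "1 - ?e t * q = 0"
    then have "cmod (?e t * q) = 1" by (metis eq_iff_diff_eq_0 norm_one)
    then show False using that by (simp add: norm_mult)
  qed
  have const: "((\<lambda>t::real. c) has_integral c) {0..1}" for c :: real
    using has_integral_const_real[of c 0 1] by simp
  show ?thesis
  proof (cases "cmod w < cmod z")
    case True
    then have "cmod z > 0" using norm_ge_zero[of w] by linarith
    with True have z: "z \<noteq> 0" "cmod (w / z) < 1" by (auto simp: norm_divide)
    have "ln (cmod (z - ?e t * w)) = ln (cmod z) + ln (cmod (1 - ?e t * (w / z)))" for t
    proof -
      have "z - ?e t * w = z * (1 - ?e t * (w / z))" using z by (simp add: field_simps)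
      then show ?thesis using z ne[of "w / z" t] by (simp add: norm_mult ln_mult)
    qed
    with has_integral_add[OF const[of "ln (cmod z)"] integral_ln_norm_circle[OF z(2)]] True show ?thesis by simp
  next
    case False
    define q where "q = cnj (z / w)"
    from False assms have "cmod w > 0" using norm_ge_zero[of z] by linarith
    with False assms have w: "w \<noteq> 0" "cmod q < 1" by (auto simp: q_def norm_divide)
    have "ln (cmod (z - ?e t * w)) = ln (cmod w) + ln (cmod (1 - ?e t * q))" for t
    proof -
      have ee: "?e t * cnj (?e t) = 1"
        by (simp add: exp_cnj mult_exp_exp)
      have "z - ?e t * w = - (?e t * w * cnj (1 - ?e t * q))"
        using w ee by (simp add: q_def field_simps)
      then have "cmod (z - ?e t * w) = cmod w * cmod (1 - ?e t * q)"
        by (simp only: norm_minus_cancel norm_mult complex_mod_cnj) (simp add: norm_mult)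
      then show ?thesis using w ne[of q t] by (simp add: ln_mult)
    qed
    with has_integral_add[OF const[of "ln (cmod w)"] integral_ln_norm_circle[OF w(2)]] False show ?thesis by simp
  qed
qed

section \<open>The logarithmic kernel as a mixture of Gaussians\<close>

lemma nn_integral_exp_minus:
  assumes "s > 0"
  shows "(\<integral>\<^sup>+t. ennreal (exp (- (t * s))) * indicator {0..} t \<partial>lborel) = ennreal (1 / s)"
proof -
  have "((\<lambda>t. - exp (- (t * s)) / s) \<longlongrightarrow> 0) at_top"
    using assms by real_asymp
  then have "(\<integral>\<^sup>+t. ennreal (exp (- (t * s))) * indicator {0..} t \<partial>lborel) = ennreal (0 - (- exp (- (0 * s)) / s))"
    using assms by (intro nn_integral_FTC_atLeast) (auto intro!: derivative_eq_intros)
  then show ?thesis by simp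
qed

text \<open>
  Frullani's integral: the integrand equals the integral of \<open>exp (- t s)\<close> over \<open>s \<in> {a..b}\<close>, and the order of integration is exchanged.
\<close>
lemma nn_integral_Frullani_pos:
  assumes "0 < a" "a \<le> b"
  shows "(\<integral>\<^sup>+t. indicator {0<..} t * ennreal ((exp (- (t * a)) - exp (- (t * b))) / t) \<partial>lborel) = ennreal (ln (b / a))"
proof -
  have inner: "ennreal ((exp (- (t * a)) - exp (- (t * b))) / t) = (\<integral>\<^sup>+s. ennreal (exp (- (t * s))) * indicator {a..b} s \<partial>lborel)"
    if "t > 0" for t
    using that assms
    by (subst nn_integral_FTC_Icc[where F="\<lambda>s. - exp (- (t * s)) / t"])
       (auto intro!: derivative_eq_intros simp: field_simps)
  have "(\<integral>\<^sup>+t. indicator {0<..} t * ennreal ((exp (- (t * a)) - exp (- (t * b))) / t) \<partial>lborel) =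
      (\<integral>\<^sup>+t. (\<integral>\<^sup>+s. indicator {0<..} t * (ennreal (exp (- (t * s))) * indicator {a..b} s) \<partial>lborel) \<partial>lborel)"
    by (intro nn_integral_cong) (auto simp: inner indicator_def nn_integral_cmult)
  also have "\<dots> = (\<integral>\<^sup>+s. (\<integral>\<^sup>+t. indicator {0<..} t * (ennreal (exp (- (t * s))) * indicator {a..b} s) \<partial>lborel) \<partial>lborel)"
    by (rule lborel_pair.Fubini'[symmetric]) measurable
  also have "\<dots> = (\<integral>\<^sup>+s. ennreal (1 / s) * indicator {a..b} s \<partial>lborel)"
  proof (rule nn_integral_cong)
    fix s :: real
    have "(\<integral>\<^sup>+t. indicator {0<..} t * (ennreal (exp (- (t * s))) * indicator {a..b} s) \<partial>lborel) =
      (\<integral>\<^sup>+t. ennreal (exp (- (t * s))) * indicator {0..} t * indicator {a..b} s \<partial>lborel)"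
      by (rule nn_integral_cong_AE) (use AE_lborel_singleton[of 0] in eventually_elim, auto simp: indicator_def)
    also have "\<dots> = ennreal (1 / s) * indicator {a..b} s"
      using assms
      by (subst nn_integral_multc, measurable) (cases "s \<in> {a..b}", auto simp: nn_integral_exp_minus)
    finally show "(\<integral>\<^sup>+t. indicator {0<..} t * (ennreal (exp (- (t * s))) * indicator {a..b} s) \<partial>lborel) =
       ennreal (1 / s) * indicator {a..b} s" .
  qed
  also have "\<dots> = ennreal (ln b - ln a)"
    using assms by (intro nn_integral_FTC_Icc) (auto intro!: derivative_eq_intros)
  finally show ?thesis using assms by (simp add: ln_div)
qed

lemma nn_integral_Frullani_zero:
  assumes "b > 0"
  shows "(\<integral>\<^sup>+t. indicator {0<..} t * ennreal ((exp (- (t * 0)) - exp (- (t * b))) / t) \<partial>lborel) = \<infinity>" (is "?I = _")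
proof -
  have "ennreal (real n) \<le> ?I" for n
  proof -
    \<comment> \<open>The integrand grows as its first exponent decreases, and this exponent makes the value exactly \<open>n\<close>.\<close>
    define a where "a = b * exp (- real n)"
    have a: "0 < a" "a \<le> b" using assms by (auto simp: a_def mult_le_cancel_left1)
    have "ennreal (real n) = ennreal (ln (b / a))"
      using assms by (simp add: a_def ln_div ln_mult exp_minus ln_inverse)
    also have "\<dots> = (\<integral>\<^sup>+t. indicator {0<..} t * ennreal ((exp (- (t * a)) - exp (- (t * b))) / t) \<partial>lborel)"
      by (rule nn_integral_Frullani_pos[OF a, symmetric])
    also have "\<dots> \<le> ?I"
      using a by (intro nn_integral_mono) (auto simp: indicator_def intro!: ennreal_leI divide_right_mono)
    finally show ?thesis .
  qed
  then show ?thesis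
    using ennreal_Ex_less_of_nat[of ?I]
    by (auto simp: ennreal_of_nat_eq_real_of_nat less_top[symmetric] not_less[symmetric])
qed

text \<open>The logarithmic kernel as a mixture of Gaussian kernels, up to a constant for each \<open>t\<close>.\<close>
lemma log_ker_gaussian:
  assumes "cmod (z - w) \<le> M" "M > 0"
  shows "log_ker M z w = (\<integral>\<^sup>+t. indicator {0<..} t *
    (ennreal ((exp (- (t * (cmod (z - w))\<^sup>2)) - exp (- (t * M\<^sup>2))) / (2 * t))) \<partial>lborel)" (is "_ = ?I")
proof -
  let ?J = "\<integral>\<^sup>+t. indicator {0<..} t * ennreal ((exp (- (t * (cmod (z - w))\<^sup>2)) - exp (- (t * M\<^sup>2))) / t) \<partial>lborel"
  have "?I = (\<integral>\<^sup>+t. ennreal (1/2) * (indicator {0<..} t * ennreal ((exp (- (t * (cmod (z - w))\<^sup>2)) - exp (- (t * M\<^sup>2))) / t)) \<partial>lborel)"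
  proof (rule nn_integral_cong)
    fix t :: real
    let ?x = "exp (- (t * (cmod (z - w))\<^sup>2)) - exp (- (t * M\<^sup>2))"
    have "ennreal (?x / (2 * t)) = ennreal (1/2) * ennreal (?x / t)"
      by (subst ennreal_mult'[symmetric]) auto
    then show "indicator {0<..} t * ennreal (?x / (2 * t)) = ennreal (1/2) * (indicator {0<..} t * ennreal (?x / t))"
      by (simp only: mult.left_commute)
  qed
  also have "\<dots> = ennreal (1/2) * ?J"
    by (rule nn_integral_cmult) measurable
  finally have I: "?I = ennreal (1/2) * ?J" .
  show ?thesis
  proof (cases "z = w")
    case True
    then have "?J = \<infinity>" using nn_integral_Frullani_zero[of "M\<^sup>2"] assms by simp
    then show ?thesis using True I by (simp add: log_ker_def ennreal_mult_top)
  next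
    case False
    then have p: "cmod (z - w) > 0" by simp
    have "?J = ennreal (ln (M\<^sup>2 / (cmod (z - w))\<^sup>2))"
      using p assms by (intro nn_integral_Frullani_pos) (auto intro: power_mono)
    also have "ln (M\<^sup>2 / (cmod (z - w))\<^sup>2) = 2 * ln (M / cmod (z - w))"
      using p assms by (simp add: ln_div ln_realpow)
    finally have "?I = ennreal (1/2 * (2 * ln (M / cmod (z - w))))"
      unfolding I by (subst ennreal_mult') simp_all
    then show ?thesis using False by (simp add: log_ker_def)
  qed
qed

text \<open>Total mass of the Gaussian \<open>exp (- t |u|\<^sup>2)\<close> on the plane.\<close>
definition gauss_mass :: "real \<Rightarrow> ennreal" where
  "gauss_mass t = (\<integral>\<^sup>+u. ennreal (exp (- (t * (cmod u)\<^sup>2))) \<partial>(lborel :: complex measure))"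

lemma gauss_mass_eq:
  assumes "t > 0"
  shows "gauss_mass t = ennreal (pi / t)"
proof -
  have lim: "((\<lambda>r. - (pi / t) * exp (- (t * r\<^sup>2))) \<longlongrightarrow> 0) at_top"
    using assms by real_asymp
  have "gauss_mass t = (\<integral>\<^sup>+r. ennreal (2 * pi * r * indicator {0..} r) * ennreal (exp (- (t * r\<^sup>2))) \<partial>lborel)"
    unfolding gauss_mass_def by (rule nn_integral_radial) measurable
  also have "\<dots> = (\<integral>\<^sup>+r. ennreal (2 * pi * r * exp (- (t * r\<^sup>2))) * indicator {0..} r \<partial>lborel)"
    by (intro nn_integral_cong) (auto simp: indicator_def ennreal_mult'[symmetric])
  also have "\<dots> = ennreal (0 - (- (pi / t) * exp (- (t * 0\<^sup>2))))"
    using assms lim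
    by (intro nn_integral_FTC_atLeast) (auto intro!: derivative_eq_intros)
  finally show ?thesis by simp
qed

text \<open>The parallelogram law, in the form that makes a Gaussian kernel a convolution square.\<close>
lemma gauss_product:
  "exp (- (2 * t * (cmod (z - u))\<^sup>2)) * exp (- (2 * t * (cmod (w - u))\<^sup>2)) =
   exp (- (t * (cmod (z - w))\<^sup>2)) * exp (- (4 * t * (cmod (- ((z + w) / 2) + u))\<^sup>2))"
proof -
  have "2 * t * (cmod (z - u))\<^sup>2 + 2 * t * (cmod (w - u))\<^sup>2 =
    t * (cmod (z - w))\<^sup>2 + 4 * t * (cmod (- ((z + w) / 2) + u))\<^sup>2"
    unfolding cmod_power2 by (simp add: power2_eq_square field_simps)
  then show ?thesis by (simp add: exp_add[symmetric] algebra_simps)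
qed

text \<open>
  Convolution of \<open>\<mu>\<close> with the Gaussian \<open>exp (- 2 t |u|\<^sup>2)\<close>. With this exponent the kernel \<open>exp (- t |z - w|\<^sup>2)\<close> is the
  convolution square, up to the factor \<^term>\<open>gauss_mass (4 * t)\<close>.
\<close>
definition gauss_conv :: "real \<Rightarrow> complex measure \<Rightarrow> complex \<Rightarrow> real" where
  "gauss_conv t \<mu> u = (\<integral>z. exp (- (2 * t * (cmod (z - u))\<^sup>2)) \<partial>\<mu>)"

text \<open>Mutual energy for the Gaussian kernel \<open>exp (- t |z - w|\<^sup>2)\<close>.\<close>
definition gauss_energy :: "real \<Rightarrow> complex measure \<Rightarrow> complex measure \<Rightarrow> ennreal" where
  "gauss_energy t \<mu> \<nu> = (\<integral>\<^sup>+z. (\<integral>\<^sup>+w. ennreal (exp (- (t * (cmod (z - w))\<^sup>2))) \<partial>\<nu>) \<partial>\<mu>)"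

text \<open>Squared \<open>L\<^sup>2\<close> distance between the Gaussian smoothings of \<open>\<mu>\<close> and \<open>\<nu>\<close>.\<close>
definition gauss_dist :: "real \<Rightarrow> complex measure \<Rightarrow> complex measure \<Rightarrow> ennreal" where
  "gauss_dist t \<mu> \<nu> = (\<integral>\<^sup>+u. ennreal ((gauss_conv t \<mu> u - gauss_conv t \<nu> u)\<^sup>2) \<partial>lborel)"

text \<open>Borel probability measures on the plane.\<close>
locale borel_prob = prob_space \<mu> for \<mu> :: "complex measure" +
  assumes sets_borel [simp, measurable_cong]: "sets \<mu> = sets borel"
begin

lemma space_UNIV [simp]: "space \<mu> = UNIV"
  using sets_eq_imp_space_eq[OF sets_borel] by simp

lemma gauss_conv_nn:
  assumes "t \<ge> 0"
  shows "ennreal (gauss_conv t \<mu> u) = (\<integral>\<^sup>+z. ennreal (exp (- (2 * t * (cmod (z - u))\<^sup>2))) \<partial>\<mu>)"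
  unfolding gauss_conv_def using assms
  by (intro nn_integral_eq_integral[symmetric] integrable_const_bound[where B=1]) auto

lemma gauss_conv_measurable [measurable]:
  "(\<lambda>p. gauss_conv (fst p) \<mu> (snd p)) \<in> borel_measurable (borel \<Otimes>\<^sub>M borel)"
  unfolding gauss_conv_def by measurable

lemma gauss_conv_measurable' [measurable (raw)]:
  assumes "f \<in> borel_measurable N" "h \<in> borel_measurable N"
  shows "(\<lambda>x. gauss_conv (f x) \<mu> (h x)) \<in> borel_measurable N"
  using measurable_compose[OF measurable_Pair[OF assms] gauss_conv_measurable] by simp

lemma gauss_conv_nonneg: "gauss_conv t \<mu> u \<ge> 0"
  unfolding gauss_conv_def by simp

end

lemma gauss_conv_mult:
  assumes \<mu>: "borel_prob \<mu>" and \<nu>: "borel_prob \<nu>" and t: "t > 0"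
  shows "(\<integral>\<^sup>+u. ennreal (gauss_conv t \<mu> u * gauss_conv t \<nu> u) \<partial>lborel) = gauss_mass (4 * t) * gauss_energy t \<mu> \<nu>"
proof -
  interpret \<mu>: borel_prob \<mu> by fact
  interpret \<nu>: borel_prob \<nu> by fact
  interpret p1: pair_sigma_finite \<mu> "lborel :: complex measure" ..
  interpret p2: pair_sigma_finite \<nu> "lborel :: complex measure" ..
  let ?e = "\<lambda>z u. ennreal (exp (- (2 * t * (cmod (z - u))\<^sup>2)))"
  have "(\<integral>\<^sup>+u. ennreal (gauss_conv t \<mu> u * gauss_conv t \<nu> u) \<partial>lborel) =
      (\<integral>\<^sup>+u. (\<integral>\<^sup>+z. ?e z u * (\<integral>\<^sup>+w. ?e w u \<partial>\<nu>) \<partial>\<mu>) \<partial>lborel)"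
    using t by (intro nn_integral_cong)
      (simp add: ennreal_mult' \<mu>.gauss_conv_nonneg \<nu>.gauss_conv_nonneg \<mu>.gauss_conv_nn \<nu>.gauss_conv_nn nn_integral_multc)
  also have "\<dots> = (\<integral>\<^sup>+z. (\<integral>\<^sup>+u. ?e z u * (\<integral>\<^sup>+w. ?e w u \<partial>\<nu>) \<partial>lborel) \<partial>\<mu>)"
    by (rule p1.Fubini') measurable
  also have "\<dots> = (\<integral>\<^sup>+z. (\<integral>\<^sup>+u. (\<integral>\<^sup>+w. ?e z u * ?e w u \<partial>\<nu>) \<partial>lborel) \<partial>\<mu>)"
    by (simp add: nn_integral_cmult)
  also have "\<dots> = (\<integral>\<^sup>+z. (\<integral>\<^sup>+w. (\<integral>\<^sup>+u. ?e z u * ?e w u \<partial>lborel) \<partial>\<nu>) \<partial>\<mu>)"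
    by (intro nn_integral_cong p2.Fubini') measurable
  also have "\<dots> = (\<integral>\<^sup>+z. (\<integral>\<^sup>+w. gauss_mass (4 * t) * ennreal (exp (- (t * (cmod (z - w))\<^sup>2))) \<partial>\<nu>) \<partial>\<mu>)"
  proof (intro nn_integral_cong)
    fix z w
    have "(\<integral>\<^sup>+u. ?e z u * ?e w u \<partial>lborel) = (\<integral>\<^sup>+u. ennreal (exp (- (t * (cmod (z - w))\<^sup>2))) *
       ennreal (exp (- (4 * t * (cmod (- ((z + w) / 2) + u))\<^sup>2))) \<partial>lborel)"
      by (intro nn_integral_cong) (simp only: ennreal_mult'[symmetric] exp_ge_zero gauss_product)
    also have "\<dots> = ennreal (exp (- (t * (cmod (z - w))\<^sup>2))) *
       (\<integral>\<^sup>+u. ennreal (exp (- (4 * t * (cmod (- ((z + w) / 2) + u))\<^sup>2))) \<partial>lborel)"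
      by (rule nn_integral_cmult) measurable
    also have "(\<integral>\<^sup>+u. ennreal (exp (- (4 * t * (cmod (- ((z + w) / 2) + u))\<^sup>2))) \<partial>lborel) = gauss_mass (4 * t)"
      unfolding gauss_mass_def
      by (rule nn_integral_lborel_translate[where f="\<lambda>u. ennreal (exp (- (4 * t * (cmod u)\<^sup>2)))"]) measurable
    finally show "(\<integral>\<^sup>+u. ?e z u * ?e w u \<partial>lborel) = gauss_mass (4 * t) * ennreal (exp (- (t * (cmod (z - w))\<^sup>2)))"
      by (simp add: mult.commute)
  qed
  also have "\<dots> = gauss_mass (4 * t) * gauss_energy t \<mu> \<nu>"
    unfolding gauss_energy_def by (simp add: nn_integral_cmult)
  finally show ?thesis .
qed

lemma gauss_energy_parallelogram:
  assumes \<mu>: "borel_prob \<mu>" and \<nu>: "borel_prob \<nu>" and t: "t > 0"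
  shows "gauss_energy t \<mu> \<mu> + gauss_energy t \<nu> \<nu> =
    2 * gauss_energy t \<mu> \<nu> + ennreal (4 * t / pi) * gauss_dist t \<mu> \<nu>"
proof -
  interpret \<mu>: borel_prob \<mu> by fact
  interpret \<nu>: borel_prob \<nu> by fact
  let ?C = "gauss_mass (4 * t)" and ?D = "ennreal (4 * t / pi)"
  have CD: "?D * ?C = 1" using t by (simp add: gauss_mass_eq ennreal_mult'[symmetric])
  have "?C * gauss_energy t \<mu> \<mu> + ?C * gauss_energy t \<nu> \<nu> =
    (\<integral>\<^sup>+u. ennreal (gauss_conv t \<mu> u * gauss_conv t \<mu> u) + ennreal (gauss_conv t \<nu> u * gauss_conv t \<nu> u) \<partial>lborel)"
    by (simp add: nn_integral_add gauss_conv_mult[OF \<mu> \<mu> t] gauss_conv_mult[OF \<nu> \<nu> t])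
  also have "\<dots> = (\<integral>\<^sup>+u. 2 * ennreal (gauss_conv t \<mu> u * gauss_conv t \<nu> u) +
      ennreal ((gauss_conv t \<mu> u - gauss_conv t \<nu> u)\<^sup>2) \<partial>lborel)"
  proof (rule nn_integral_cong)
    fix u
    define a b where "a = gauss_conv t \<mu> u" and "b = gauss_conv t \<nu> u"
    have "a \<ge> 0" "b \<ge> 0" by (simp_all add: a_def b_def \<mu>.gauss_conv_nonneg \<nu>.gauss_conv_nonneg)
    have "ennreal (a * a) + ennreal (b * b) = ennreal 2 * ennreal (a * b) + ennreal ((a - b)\<^sup>2)"
    proof -
      have "ennreal (a * a) + ennreal (b * b) = ennreal (a * a + b * b)"
        using \<open>a \<ge> 0\<close> \<open>b \<ge> 0\<close> by simp
      also have "a * a + b * b = 2 * (a * b) + (a - b)\<^sup>2"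
        by (simp add: power2_eq_square algebra_simps)
      also have "ennreal \<dots> = ennreal (2 * (a * b)) + ennreal ((a - b)\<^sup>2)"
        using \<open>a \<ge> 0\<close> \<open>b \<ge> 0\<close> by (intro ennreal_plus) auto
      also have "ennreal (2 * (a * b)) = ennreal 2 * ennreal (a * b)"
        by (rule ennreal_mult') simp
      finally show ?thesis .
    qed
    then show "ennreal (gauss_conv t \<mu> u * gauss_conv t \<mu> u) + ennreal (gauss_conv t \<nu> u * gauss_conv t \<nu> u) =
      2 * ennreal (gauss_conv t \<mu> u * gauss_conv t \<nu> u) + ennreal ((gauss_conv t \<mu> u - gauss_conv t \<nu> u)\<^sup>2)"
      by (simp add: a_def b_def)
  qed
  also have "\<dots> = 2 * (?C * gauss_energy t \<mu> \<nu>) + gauss_dist t \<mu> \<nu>"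
    unfolding gauss_dist_def by (simp add: nn_integral_add nn_integral_cmult gauss_conv_mult[OF \<mu> \<nu> t])
  finally have "?D * (?C * gauss_energy t \<mu> \<mu> + ?C * gauss_energy t \<nu> \<nu>) = ?D * (2 * (?C * gauss_energy t \<mu> \<nu>) + gauss_dist t \<mu> \<nu>)"
    by simp
  then have "(?D * ?C) * gauss_energy t \<mu> \<mu> + (?D * ?C) * gauss_energy t \<nu> \<nu> =
      2 * ((?D * ?C) * gauss_energy t \<mu> \<nu>) + ?D * gauss_dist t \<mu> \<nu>"
    by (simp add: distrib_left mult_ac)
  then show ?thesis by (simp add: CD)
qed

text \<open>
  The contribution of the parameter \<open>t\<close> to the mutual energy. The constant \<open>exp (- t M\<^sup>2)\<close> makes the integrand
  nonnegative for \<open>|z - w| \<le> M\<close>; for probability measures it contributes the same amount to all slices and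
  therefore cancels in the parallelogram identity.
\<close>
definition gauss_slice :: "real \<Rightarrow> real \<Rightarrow> complex measure \<Rightarrow> complex measure \<Rightarrow> ennreal" where
  "gauss_slice M t \<mu> \<nu> =
    (\<integral>\<^sup>+z. (\<integral>\<^sup>+w. ennreal ((exp (- (t * (cmod (z - w))\<^sup>2)) - exp (- (t * M\<^sup>2))) / (2 * t)) \<partial>\<nu>) \<partial>\<mu>)"

lemma gauss_slice_eq:
  assumes \<mu>: "borel_prob \<mu>" "AE z in \<mu>. cmod z \<le> R" and \<nu>: "borel_prob \<nu>" "AE z in \<nu>. cmod z \<le> R"
    and t: "t > 0" and M: "2 * R \<le> M" "M > 0"
  shows "gauss_slice M t \<mu> \<nu> + ennreal (exp (- (t * M\<^sup>2)) / (2 * t)) = ennreal (1 / (2 * t)) * gauss_energy t \<mu> \<nu>"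
proof -
  interpret \<mu>: borel_prob \<mu> by fact
  interpret \<nu>: borel_prob \<nu> by fact
  let ?c = "ennreal (exp (- (t * M\<^sup>2)) / (2 * t))"
  let ?k = "\<lambda>z w. ennreal ((exp (- (t * (cmod (z - w))\<^sup>2)) - exp (- (t * M\<^sup>2))) / (2 * t))"
  have "gauss_slice M t \<mu> \<nu> + ?c = (\<integral>\<^sup>+z. (\<integral>\<^sup>+w. ?k z w \<partial>\<nu>) \<partial>\<mu>) + (\<integral>\<^sup>+z. (\<integral>\<^sup>+w. ?c \<partial>\<nu>) \<partial>\<mu>)"
    using \<mu>.emeasure_space_1 \<nu>.emeasure_space_1 by (simp add: gauss_slice_def)
  also have "\<dots> = (\<integral>\<^sup>+z. (\<integral>\<^sup>+w. ?k z w \<partial>\<nu>) + (\<integral>\<^sup>+w. ?c \<partial>\<nu>) \<partial>\<mu>)"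
    by (rule nn_integral_add[symmetric]) measurable
  also have "\<dots> = (\<integral>\<^sup>+z. (\<integral>\<^sup>+w. ?k z w + ?c \<partial>\<nu>) \<partial>\<mu>)"
    by (intro nn_integral_cong nn_integral_add[symmetric]) measurable
  also have "\<dots> = (\<integral>\<^sup>+z. (\<integral>\<^sup>+w. ennreal (1 / (2 * t)) * ennreal (exp (- (t * (cmod (z - w))\<^sup>2))) \<partial>\<nu>) \<partial>\<mu>)"
  proof (rule nn_integral_cong_AE, use \<mu>(2) in eventually_elim, rule nn_integral_cong_AE, use \<nu>(2) in eventually_elim)
    fix z w assume "cmod z \<le> R" "cmod w \<le> R"
    then have "cmod (z - w) \<le> M" using norm_triangle_ineq4[of z w] M by linarith
    then have "(cmod (z - w))\<^sup>2 \<le> M\<^sup>2" by (intro power_mono) auto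
    then have "exp (- (t * M\<^sup>2)) \<le> exp (- (t * (cmod (z - w))\<^sup>2))" using t by simp
    then have "?k z w + ?c = ennreal ((exp (- (t * (cmod (z - w))\<^sup>2)) - exp (- (t * M\<^sup>2))) / (2 * t) + exp (- (t * M\<^sup>2)) / (2 * t))"
      using t by (intro ennreal_plus[symmetric]) auto
    also have "\<dots> = ennreal (1 / (2 * t) * exp (- (t * (cmod (z - w))\<^sup>2)))"
      by (simp add: add_divide_distrib[symmetric])
    also have "\<dots> = ennreal (1 / (2 * t)) * ennreal (exp (- (t * (cmod (z - w))\<^sup>2)))"
      using t by (intro ennreal_mult) auto
    finally show "?k z w + ?c = ennreal (1 / (2 * t)) * ennreal (exp (- (t * (cmod (z - w))\<^sup>2)))" .
  qed
  also have "\<dots> = ennreal (1 / (2 * t)) * gauss_energy t \<mu> \<nu>"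
    unfolding gauss_energy_def by (simp add: nn_integral_cmult)
  finally show ?thesis .
qed

lemma mutual_energy_gauss_slice:
  assumes \<mu>: "borel_prob \<mu>" "AE z in \<mu>. cmod z \<le> R" and \<nu>: "borel_prob \<nu>" "AE z in \<nu>. cmod z \<le> R"
    and M: "2 * R \<le> M" "M > 0"
  shows "mutual_energy M \<mu> \<nu> = (\<integral>\<^sup>+t. indicator {0<..} t * gauss_slice M t \<mu> \<nu> \<partial>lborel)"
proof -
  interpret \<mu>: borel_prob \<mu> by fact
  interpret \<nu>: borel_prob \<nu> by fact
  interpret p1: pair_sigma_finite \<mu> "lborel :: real measure" ..
  interpret p2: pair_sigma_finite \<nu> "lborel :: real measure" ..
  let ?k = "\<lambda>t z w. ennreal ((exp (- (t * (cmod (z - w))\<^sup>2)) - exp (- (t * M\<^sup>2))) / (2 * t))"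
  have "mutual_energy M \<mu> \<nu> = (\<integral>\<^sup>+z. (\<integral>\<^sup>+w. (\<integral>\<^sup>+t. indicator {0<..} t * ?k t z w \<partial>lborel) \<partial>\<nu>) \<partial>\<mu>)"
    unfolding mutual_energy_def log_pot_def
  proof (rule nn_integral_cong_AE, use \<mu>(2) in eventually_elim, rule nn_integral_cong_AE, use \<nu>(2) in eventually_elim)
    fix z w assume "cmod z \<le> R" "cmod w \<le> R"
    then have "cmod (z - w) \<le> M" using norm_triangle_ineq4[of z w] M by linarith
    then show "log_ker M z w = (\<integral>\<^sup>+t. indicator {0<..} t * ?k t z w \<partial>lborel)"
      by (rule log_ker_gaussian) (rule M)
  qed
  also have "\<dots> = (\<integral>\<^sup>+z. (\<integral>\<^sup>+t. (\<integral>\<^sup>+w. indicator {0<..} t * ?k t z w \<partial>\<nu>) \<partial>lborel) \<partial>\<mu>)"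
    by (intro nn_integral_cong p2.Fubini'[symmetric]) measurable
  also have "\<dots> = (\<integral>\<^sup>+t. (\<integral>\<^sup>+z. (\<integral>\<^sup>+w. indicator {0<..} t * ?k t z w \<partial>\<nu>) \<partial>\<mu>) \<partial>lborel)"
    by (intro p1.Fubini'[symmetric]) measurable
  also have "\<dots> = (\<integral>\<^sup>+t. indicator {0<..} t * gauss_slice M t \<mu> \<nu> \<partial>lborel)"
    unfolding gauss_slice_def by (simp add: nn_integral_cmult)
  finally show ?thesis .
qed

lemma gauss_slice_measurable [measurable]:
  assumes \<mu>: "borel_prob \<mu>" and \<nu>: "borel_prob \<nu>"
  shows "(\<lambda>t. gauss_slice M t \<mu> \<nu>) \<in> borel_measurable borel"
proof -
  interpret \<mu>: borel_prob \<mu> by fact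
  interpret \<nu>: borel_prob \<nu> by fact
  show ?thesis unfolding gauss_slice_def by measurable
qed

lemma gauss_dist_measurable [measurable]:
  assumes \<mu>: "borel_prob \<mu>" and \<nu>: "borel_prob \<nu>"
  shows "(\<lambda>t. gauss_dist t \<mu> \<nu>) \<in> borel_measurable borel"
proof -
  interpret \<mu>: borel_prob \<mu> by fact
  interpret \<nu>: borel_prob \<nu> by fact
  show ?thesis unfolding gauss_dist_def by measurable
qed

text \<open>
  If the energies are finite, the last summand is the energy of the signed measure \<open>\<mu> - \<nu>\<close>, exhibited as a nonnegative quantity. As no
  subtraction occurs, the identity also holds when energies are infinite.
\<close>
lemma mutual_energy_parallelogram:
  assumes \<mu>: "borel_prob \<mu>" "AE z in \<mu>. cmod z \<le> R" and \<nu>: "borel_prob \<nu>" "AE z in \<nu>. cmod z \<le> R"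
    and M: "2 * R \<le> M" "M > 0"
  shows "mutual_energy M \<mu> \<mu> + mutual_energy M \<nu> \<nu> =
    2 * mutual_energy M \<mu> \<nu> + ennreal (2 / pi) * (\<integral>\<^sup>+t. indicator {0<..} t * gauss_dist t \<mu> \<nu> \<partial>lborel)"
proof -
  note [measurable] = gauss_slice_measurable[OF \<mu>(1) \<mu>(1)] gauss_slice_measurable[OF \<nu>(1) \<nu>(1)]
    gauss_slice_measurable[OF \<mu>(1) \<nu>(1)] gauss_dist_measurable[OF \<mu>(1) \<nu>(1)]
  have slice: "gauss_slice M t \<mu> \<mu> + gauss_slice M t \<nu> \<nu> = 2 * gauss_slice M t \<mu> \<nu> + ennreal (2 / pi) * gauss_dist t \<mu> \<nu>"
    if "t > 0" for t
  proof -
    let ?c = "ennreal (exp (- (t * M\<^sup>2)) / (2 * t))" and ?h = "ennreal (1 / (2 * t))"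
    have "(gauss_slice M t \<mu> \<mu> + gauss_slice M t \<nu> \<nu>) + (?c + ?c) =
        (gauss_slice M t \<mu> \<mu> + ?c) + (gauss_slice M t \<nu> \<nu> + ?c)" by (simp add: ac_simps)
    also have "\<dots> = ?h * (gauss_energy t \<mu> \<mu> + gauss_energy t \<nu> \<nu>)"
      by (simp add: gauss_slice_eq[OF \<mu> \<mu> that M] gauss_slice_eq[OF \<nu> \<nu> that M] distrib_left)
    also have "\<dots> = 2 * (?h * gauss_energy t \<mu> \<nu>) + ?h * ennreal (4 * t / pi) * gauss_dist t \<mu> \<nu>"
      by (simp add: gauss_energy_parallelogram[OF \<mu>(1) \<nu>(1) that] distrib_left mult_ac)
    also have "?h * ennreal (4 * t / pi) = ennreal (2 / pi)"
      using that by (simp add: ennreal_mult'[symmetric])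
    also have "?h * gauss_energy t \<mu> \<nu> = gauss_slice M t \<mu> \<nu> + ?c"
      by (rule gauss_slice_eq[OF \<mu> \<nu> that M, symmetric])
    also have "2 * (gauss_slice M t \<mu> \<nu> + ?c) + ennreal (2 / pi) * gauss_dist t \<mu> \<nu> =
       (2 * gauss_slice M t \<mu> \<nu> + ennreal (2 / pi) * gauss_dist t \<mu> \<nu>) + (?c + ?c)"
      by (simp add: distrib_left mult_2 ac_simps)
    finally show ?thesis
      by (metis (no_types, lifting) add.commute ennreal_add_left_cancel ennreal_add_eq_top ennreal_neq_top infinity_ennreal_def)
  qed
  have "mutual_energy M \<mu> \<mu> + mutual_energy M \<nu> \<nu> =
    (\<integral>\<^sup>+t. indicator {0<..} t * gauss_slice M t \<mu> \<mu> + indicator {0<..} t * gauss_slice M t \<nu> \<nu> \<partial>lborel)"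
    by (simp add: mutual_energy_gauss_slice[OF \<mu> \<mu> M] mutual_energy_gauss_slice[OF \<nu> \<nu> M] nn_integral_add)
  also have "\<dots> = (\<integral>\<^sup>+t. 2 * (indicator {0<..} t * gauss_slice M t \<mu> \<nu>) + ennreal (2 / pi) * (indicator {0<..} t * gauss_dist t \<mu> \<nu>) \<partial>lborel)"
    by (intro nn_integral_cong) (auto simp: indicator_def slice)
  also have "\<dots> = 2 * mutual_energy M \<mu> \<nu> + ennreal (2 / pi) * (\<integral>\<^sup>+t. indicator {0<..} t * gauss_dist t \<mu> \<nu> \<partial>lborel)"
    by (simp add: mutual_energy_gauss_slice[OF \<mu> \<nu> M] nn_integral_add nn_integral_cmult)
  finally show ?thesis .
qed

section \<open>Gaussian smoothings determine a measure\<close>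

text \<open>
  Average of \<open>f\<close> around \<open>z\<close> with a Gaussian weight of width proportional to \<open>c\<close>, not normalized: the weight has
  mass \<^term>\<open>gauss_mass 2\<close>.
\<close>
definition gauss_avg :: "(complex \<Rightarrow> real) \<Rightarrow> real \<Rightarrow> complex \<Rightarrow> ennreal" where
  "gauss_avg f c z = (\<integral>\<^sup>+v. ennreal (f (z + c *\<^sub>R v)) * ennreal (exp (- (2 * (cmod v)\<^sup>2))) \<partial>lborel)"

lemma nn_integral_lborel_affine:
  fixes f :: "complex \<Rightarrow> ennreal"
  assumes [measurable]: "f \<in> borel_measurable borel" and "c > 0"
  shows "(\<integral>\<^sup>+u. f u \<partial>lborel) = ennreal (c\<^sup>2) * (\<integral>\<^sup>+v. f (z + c *\<^sub>R v) \<partial>lborel)"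
proof -
  have "(\<integral>\<^sup>+u. f u \<partial>lborel) = (\<integral>\<^sup>+u. f u \<partial>density (distr lborel borel (\<lambda>x. z + c *\<^sub>R x)) (\<lambda>_. \<bar>c\<bar>^DIM(complex)))"
    using \<open>c > 0\<close> by (subst lborel_affine[of c z]) auto
  also have "\<dots> = ennreal (c\<^sup>2) * (\<integral>\<^sup>+v. f (z + c *\<^sub>R v) \<partial>lborel)"
    using \<open>c > 0\<close> by (simp add: nn_integral_density nn_integral_distr nn_integral_cmult)
  finally show ?thesis .
qed

lemma nn_integral_gauss_conv:
  assumes \<mu>: "borel_prob \<mu>" and [measurable]: "f \<in> borel_measurable borel" and c: "c > 0"
  shows "(\<integral>\<^sup>+u. ennreal (f u) * ennreal (gauss_conv (1 / c\<^sup>2) \<mu> u) \<partial>lborel) = ennreal (c\<^sup>2) * (\<integral>\<^sup>+z. gauss_avg f c z \<partial>\<mu>)"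
proof -
  interpret \<mu>: borel_prob \<mu> by fact
  interpret p1: pair_sigma_finite \<mu> "lborel :: complex measure" ..
  let ?e = "\<lambda>z u. ennreal (exp (- (2 * (1 / c\<^sup>2) * (cmod (z - u))\<^sup>2)))"
  have "(\<integral>\<^sup>+u. ennreal (f u) * ennreal (gauss_conv (1 / c\<^sup>2) \<mu> u) \<partial>lborel) =
      (\<integral>\<^sup>+u. (\<integral>\<^sup>+z. ennreal (f u) * ?e z u \<partial>\<mu>) \<partial>lborel)"
    by (simp add: \<mu>.gauss_conv_nn nn_integral_cmult)
  also have "\<dots> = (\<integral>\<^sup>+z. (\<integral>\<^sup>+u. ennreal (f u) * ?e z u \<partial>lborel) \<partial>\<mu>)"
    by (rule p1.Fubini') measurable
  also have "\<dots> = (\<integral>\<^sup>+z. ennreal (c\<^sup>2) * gauss_avg f c z \<partial>\<mu>)"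
  proof (rule nn_integral_cong)
    fix z
    have "(\<integral>\<^sup>+u. ennreal (f u) * ?e z u \<partial>lborel) =
        ennreal (c\<^sup>2) * (\<integral>\<^sup>+v. ennreal (f (z + c *\<^sub>R v)) * ?e z (z + c *\<^sub>R v) \<partial>lborel)"
      using c by (intro nn_integral_lborel_affine) measurable
    also have "(\<integral>\<^sup>+v. ennreal (f (z + c *\<^sub>R v)) * ?e z (z + c *\<^sub>R v) \<partial>lborel) = gauss_avg f c z"
      unfolding gauss_avg_def using c by (intro nn_integral_cong) (simp add: power_mult_distrib)
    finally show "(\<integral>\<^sup>+u. ennreal (f u) * ?e z u \<partial>lborel) = ennreal (c\<^sup>2) * gauss_avg f c z" .
  qed
  also have "\<dots> = ennreal (c\<^sup>2) * (\<integral>\<^sup>+z. gauss_avg f c z \<partial>\<mu>)"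
    by (rule nn_integral_cmult) (unfold gauss_avg_def, measurable)
  finally show ?thesis .
qed

text \<open>The Gaussians form an approximate identity, up to normalization.\<close>
lemma gauss_avg_limit:
  assumes \<mu>: "borel_prob \<mu>" and cont: "continuous_on UNIV f" and f: "\<And>z. f z \<le> 1"
    and c: "c \<longlonglongrightarrow> 0"
  shows "(\<lambda>n. \<integral>\<^sup>+z. gauss_avg f (c n) z \<partial>\<mu>) \<longlonglongrightarrow> (\<integral>\<^sup>+z. ennreal (f z) \<partial>\<mu>) * gauss_mass 2"
proof -
  interpret \<mu>: borel_prob \<mu> by fact
  have [measurable]: "f \<in> borel_measurable borel" using cont by (rule borel_measurable_continuous_onI)
  have fin: "gauss_mass 2 < \<infinity>" by (simp add: gauss_mass_eq)
  have avg_le: "gauss_avg f (c n) z \<le> gauss_mass 2" for n z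
    unfolding gauss_avg_def gauss_mass_def
    using f by (intro nn_integral_mono) (metis ennreal_leI ennreal_1 mult_1 mult_right_mono zero_le)
  have avg_lim: "(\<lambda>n. gauss_avg f (c n) z) \<longlonglongrightarrow> ennreal (f z) * gauss_mass 2" for z
  proof -
    have "(\<lambda>n. \<integral>\<^sup>+v. ennreal (f (z + c n *\<^sub>R v)) * ennreal (exp (- (2 * (cmod v)\<^sup>2))) \<partial>lborel) \<longlonglongrightarrow>
       (\<integral>\<^sup>+v. ennreal (f z) * ennreal (exp (- (2 * (cmod v)\<^sup>2))) \<partial>lborel)"
    proof (rule nn_integral_dominated_convergence[where w="\<lambda>v. ennreal (exp (- (2 * (cmod v)\<^sup>2)))"])
      show "AE v in lborel. ennreal (f (z + c n *\<^sub>R v)) * ennreal (exp (- (2 * (cmod v)\<^sup>2))) \<le> ennreal (exp (- (2 * (cmod v)\<^sup>2)))" for n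
        using f by (intro always_eventually allI) (metis ennreal_leI ennreal_1 mult_1 mult_right_mono zero_le)
      show "(\<integral>\<^sup>+v. ennreal (exp (- (2 * (cmod v)\<^sup>2))) \<partial>(lborel :: complex measure)) < \<infinity>"
        using fin by (simp add: gauss_mass_def)
      show "AE v in lborel. (\<lambda>n. ennreal (f (z + c n *\<^sub>R v)) * ennreal (exp (- (2 * (cmod v)\<^sup>2)))) \<longlonglongrightarrow>
          ennreal (f z) * ennreal (exp (- (2 * (cmod v)\<^sup>2)))"
      proof (intro always_eventually allI)
        fix v
        have "(\<lambda>n. z + c n *\<^sub>R v) \<longlonglongrightarrow> z + 0 *\<^sub>R v" using c by (intro tendsto_intros)
        then have "(\<lambda>n. f (z + c n *\<^sub>R v)) \<longlonglongrightarrow> f z"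
          using continuous_on_tendsto_compose[OF cont, of "\<lambda>n. z + c n *\<^sub>R v" z] by simp
        then show "(\<lambda>n. ennreal (f (z + c n *\<^sub>R v)) * ennreal (exp (- (2 * (cmod v)\<^sup>2)))) \<longlonglongrightarrow>
          ennreal (f z) * ennreal (exp (- (2 * (cmod v)\<^sup>2)))"
          by (intro tendsto_mult_ennreal tendsto_ennrealI tendsto_const) auto
      qed
    qed measurable
    then show ?thesis by (simp add: gauss_avg_def gauss_mass_def nn_integral_cmult)
  qed
  have "(\<lambda>n. \<integral>\<^sup>+z. gauss_avg f (c n) z \<partial>\<mu>) \<longlonglongrightarrow> (\<integral>\<^sup>+z. ennreal (f z) * gauss_mass 2 \<partial>\<mu>)"
  proof (rule nn_integral_dominated_convergence[where w="\<lambda>_. gauss_mass 2"])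
    show "(\<integral>\<^sup>+z. gauss_mass 2 \<partial>\<mu>) < \<infinity>" using fin \<mu>.emeasure_space_1 by simp
    show "(\<lambda>z. gauss_avg f (c n) z) \<in> borel_measurable \<mu>" for n unfolding gauss_avg_def by measurable
  qed (use avg_le avg_lim in auto)
  then show ?thesis by (simp add: nn_integral_multc)
qed

lemma measure_eq_of_continuous:
  assumes \<mu>: "borel_prob \<mu>" and \<nu>: "borel_prob \<nu>"
    and eq: "\<And>f. continuous_on UNIV f \<Longrightarrow> (\<And>z. 0 \<le> f z) \<Longrightarrow> (\<And>z. f z \<le> 1) \<Longrightarrow>
      (\<integral>\<^sup>+z. ennreal (f z) \<partial>\<mu>) = (\<integral>\<^sup>+z. ennreal (f z) \<partial>\<nu>)"
  shows "\<mu> = \<nu>"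
proof (rule measure_eqI_generator_eq)
  interpret \<mu>: borel_prob \<mu> by fact
  interpret \<nu>: borel_prob \<nu> by fact
  let ?E = "Collect closed :: complex set set"
  show "Int_stable ?E" by (auto simp: Int_stable_def)
  show "sets \<mu> = sigma_sets UNIV ?E" "sets \<nu> = sigma_sets UNIV ?E"
    by (simp_all add: borel_eq_closed)
  show "range (\<lambda>i::nat. UNIV) \<subseteq> ?E" "(\<Union>i::nat. UNIV) = (UNIV :: complex set)" by auto
  show "emeasure \<mu> UNIV \<noteq> \<infinity>" using \<mu>.emeasure_space_1 by simp
  fix S :: "complex set" assume "S \<in> ?E"
  then have S: "closed S" by simp
  show "emeasure \<mu> S = emeasure \<nu> S"
  proof (cases "S = {}")
    case False
    have [measurable]: "S \<in> sets borel" using S by simp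
    \<comment> \<open>Continuous functions decreasing to the indicator function of the closed set \<open>S\<close>.\<close>
    define f where "f n z = max 0 (1 - real n * infdist z S)" for n z
    have cont: "continuous_on UNIV (f n)" for n
      unfolding f_def by (intro continuous_intros)
    have [measurable]: "f n \<in> borel_measurable borel" for n
      using cont by (rule borel_measurable_continuous_onI)
    have bd: "0 \<le> f n z" "f n z \<le> 1" for n z
      by (auto simp: f_def infdist_nonneg)
    have lim: "(\<lambda>n. ennreal (f n z)) \<longlonglongrightarrow> indicator S z" for z
    proof (cases "z \<in> S")
      case True
      then show ?thesis by (simp add: f_def)
    next
      case zS: False
      then have d: "infdist z S > 0"
        using in_closed_iff_infdist_zero[OF S False] infdist_nonneg[of z S] by (metis less_eq_real_def)
      obtain N where N: "1 / infdist z S < real N" using reals_Archimedean2 by blast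
      have "f n z = 0" if "n \<ge> N" for n
      proof -
        have "1 / infdist z S < real n" using N that by simp
        then have "1 < real n * infdist z S" using d by (simp add: field_simps)
        then show ?thesis by (simp add: f_def)
      qed
      then have "eventually (\<lambda>n. ennreal (f n z) = indicator S z) sequentially"
        using zS unfolding eventually_sequentially by (metis ennreal_0 indicator_simps(2))
      then show ?thesis by (rule tendsto_eventually)
    qed
    have conv: "(\<lambda>n. \<integral>\<^sup>+z. ennreal (f n z) \<partial>\<rho>) \<longlonglongrightarrow> emeasure \<rho> S" if "borel_prob \<rho>" for \<rho>
    proof -
      interpret \<rho>: borel_prob \<rho> by fact
      have "(\<lambda>n. \<integral>\<^sup>+z. ennreal (f n z) \<partial>\<rho>) \<longlonglongrightarrow> (\<integral>\<^sup>+z. indicator S z \<partial>\<rho>)"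
        by (rule nn_integral_dominated_convergence[where w="\<lambda>_. 1"])
           (use bd lim \<rho>.emeasure_space_1 in \<open>auto simp: ennreal_le_1\<close>)
      then show ?thesis by simp
    qed
    from conv[OF \<mu>] conv[OF \<nu>] eq[OF cont bd] show ?thesis
      by (auto intro: LIMSEQ_unique)
  qed simp
qed auto

text \<open>
  The smoothings agree almost everywhere for almost every \<open>t\<close>, in particular for some sequence of parameters tending
  to infinity. Integrals of continuous functions against \<open>\<mu>\<close> and \<open>\<nu>\<close> then agree in the limit.
\<close>
lemma gauss_dist_eq_0_imp_eq:
  assumes \<mu>: "borel_prob \<mu>" and \<nu>: "borel_prob \<nu>"
    and zero: "(\<integral>\<^sup>+t. indicator {0<..} t * gauss_dist t \<mu> \<nu> \<partial>lborel) = 0"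
  shows "\<mu> = \<nu>"
proof -
  interpret \<mu>: borel_prob \<mu> by fact
  interpret \<nu>: borel_prob \<nu> by fact
  note [measurable] = gauss_dist_measurable[OF \<mu> \<nu>]
  have ae: "AE t in lborel. indicator {0<..} t * gauss_dist t \<mu> \<nu> = 0"
    using zero by (subst (asm) nn_integral_0_iff_AE) auto
  have "\<exists>t\<ge>real n + 1. gauss_dist t \<mu> \<nu> = 0" for n
  proof (rule ccontr)
    assume *: "\<not> ?thesis"
    have "AE t in lborel. t \<notin> {real n + 1..real n + 2}"
      using ae by eventually_elim (use * in \<open>auto simp: indicator_def split: if_splits\<close>)
    then have "emeasure lborel {real n + 1..real n + 2} = 0"
      using AE_iff_null_sets[of "{real n + 1..real n + 2}" lborel] by (simp add: null_sets_def)
    then show False by simp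
  qed
  then obtain t where t: "\<And>n. t n \<ge> real n + 1" "\<And>n. gauss_dist (t n) \<mu> \<nu> = 0" by metis
  have tpos: "t n > 0" for n using t(1)[of n] by linarith
  define c where "c n = 1 / sqrt (t n)" for n
  have c: "c n > 0" "1 / (c n)\<^sup>2 = t n" for n
    using tpos[of n] by (auto simp: c_def power_divide)
  have "filterlim t at_top sequentially"
    using t(1) by (intro filterlim_at_top_mono[OF filterlim_real_sequentially])
      (auto intro!: always_eventually order_trans[OF _ t(1)])
  then have "filterlim (\<lambda>n. sqrt (t n)) at_top sequentially"
    by (rule filterlim_compose[OF sqrt_at_top])
  then have c0: "c \<longlonglongrightarrow> 0"
    unfolding c_def using tendsto_divide_0[OF tendsto_const, of "\<lambda>n. sqrt (t n)"] filterlim_at_top_imp_at_infinity by blast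
  show ?thesis
  proof (rule measure_eq_of_continuous[OF \<mu> \<nu>])
    fix f :: "complex \<Rightarrow> real"
    assume f: "continuous_on UNIV f" "\<And>z. 0 \<le> f z" "\<And>z. f z \<le> 1"
    have [measurable]: "f \<in> borel_measurable borel" using f(1) by (rule borel_measurable_continuous_onI)
    have "(\<integral>\<^sup>+z. gauss_avg f (c n) z \<partial>\<mu>) = (\<integral>\<^sup>+z. gauss_avg f (c n) z \<partial>\<nu>)" for n
    proof -
      have "AE u in lborel. ennreal ((gauss_conv (t n) \<mu> u - gauss_conv (t n) \<nu> u)\<^sup>2) = 0"
        using t(2)[of n] unfolding gauss_dist_def by (subst (asm) nn_integral_0_iff_AE) auto
      then have "AE u in lborel. gauss_conv (t n) \<mu> u = gauss_conv (t n) \<nu> u"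
        by eventually_elim simp
      then have "(\<integral>\<^sup>+u. ennreal (f u) * ennreal (gauss_conv (t n) \<mu> u) \<partial>lborel) =
          (\<integral>\<^sup>+u. ennreal (f u) * ennreal (gauss_conv (t n) \<nu> u) \<partial>lborel)"
        by (intro nn_integral_cong_AE) (auto elim: eventually_mono)
      then have "ennreal ((c n)\<^sup>2) * (\<integral>\<^sup>+z. gauss_avg f (c n) z \<partial>\<mu>) = ennreal ((c n)\<^sup>2) * (\<integral>\<^sup>+z. gauss_avg f (c n) z \<partial>\<nu>)"
        using nn_integral_gauss_conv[OF \<mu> _ c(1)[of n], of f] nn_integral_gauss_conv[OF \<nu> _ c(1)[of n], of f] c(2)[of n] by simp
      then show ?thesis using c(1)[of n]
        by (metis ennreal_mult_divide_eq ennreal_neq_top ennreal_eq_0_iff mult.commute not_le zero_less_power)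
    qed
    then have "(\<integral>\<^sup>+z. ennreal (f z) \<partial>\<mu>) * gauss_mass 2 = (\<integral>\<^sup>+z. ennreal (f z) \<partial>\<nu>) * gauss_mass 2"
      using gauss_avg_limit[OF \<mu> f(1,3) c0] gauss_avg_limit[OF \<nu> f(1,3) c0] LIMSEQ_unique by auto
    moreover have "gauss_mass 2 \<noteq> 0" "gauss_mass 2 \<noteq> \<top>" by (auto simp: gauss_mass_eq ennreal_eq_0_iff not_le)
    ultimately show "(\<integral>\<^sup>+z. ennreal (f z) \<partial>\<mu>) = (\<integral>\<^sup>+z. ennreal (f z) \<partial>\<nu>)"
      by (metis ennreal_mult_divide_eq)
  qed
qed

section \<open>The potential of the equilibrium measure of the plane\<close>

text \<open>An external field together with a solution \<open>T\<close> of \<open>t g'(t) = 2\<close>.\<close>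
locale admissible_field =
  fixes g :: "real \<Rightarrow> real" and T :: real
  assumes ext: "external_field g" and T_pos: "T > 0" and T_eq: "T * deriv g T = 2"
begin

text \<open>
  The function \<open>r g'(r)\<close>, extended by 0. The extension is monotone on the whole line and continuous at 0, whatever the
  values of \<^term>\<open>deriv g\<close> at nonpositive arguments.
\<close>
definition h :: "real \<Rightarrow> real" where
  "h r = (if 0 < r then r * deriv g r else 0)"

text \<open>The derivative of \<^term>\<open>h\<close> at positive arguments.\<close>
definition h' :: "real \<Rightarrow> real" where
  "h' r = deriv g r + r * deriv (deriv g) r"

text \<open>
  The radial density \<open>(g'' + g'/r)/(4 \<pi>) = (r g')'/(4 \<pi> r)\<close>. The value 0 at nonpositive arguments makes it Borel
  measurable and changes the measure nowhere.
\<close>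
definition rdens :: "real \<Rightarrow> real" where
  "rdens r = (if 0 < r then h' r / (4 * pi * r) else 0)"

lemma g_nonneg: "r \<ge> 0 \<Longrightarrow> g r \<ge> 0"
  using ext by (auto simp: external_field_def)

lemma g_mono: "0 \<le> r \<Longrightarrow> r \<le> s \<Longrightarrow> g r \<le> g s"
  using ext by (auto simp: external_field_def mono_on_def)

lemma g_deriv: "r > 0 \<Longrightarrow> (g has_real_derivative deriv g r) (at r)"
  using ext by (auto simp: external_field_def DERIV_deriv_iff_real_differentiable)

lemma g_deriv2: "r > 0 \<Longrightarrow> (deriv g has_real_derivative deriv (deriv g) r) (at r)"
  using ext by (auto simp: external_field_def DERIV_deriv_iff_real_differentiable)

lemma h_deriv:
  assumes "r > 0"
  shows "(h has_real_derivative h' r) (at r)"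
proof -
  have "((\<lambda>r. r * deriv g r) has_real_derivative h' r) (at r)"
    unfolding h'_def using g_deriv2[OF assms] by (auto intro!: derivative_eq_intros)
  moreover have "eventually (\<lambda>x. x \<in> {0<..}) (nhds r)"
    using assms by (intro eventually_nhds_in_open) auto
  then have "eventually (\<lambda>x. h x = x * deriv g x) (nhds r)"
    by eventually_elim (simp add: h_def)
  ultimately show ?thesis by (subst DERIV_cong_ev) auto
qed

lemma h_tendsto: "(h \<longlongrightarrow> 0) (at_right 0)"
proof -
  have "((\<lambda>r. r * deriv g r) \<longlongrightarrow> 0) (at_right 0)"
    using ext by (simp add: external_field_def)
  moreover have "eventually (\<lambda>r. r * deriv g r = h r) (at_right 0)"
    using eventually_at_right_less[of 0] by eventually_elim (simp add: h_def)
  ultimately show ?thesis by (rule Lim_transform_eventually)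
qed

lemma h_mono_pos: "0 < r \<Longrightarrow> r \<le> s \<Longrightarrow> h r \<le> h s"
  using ext by (auto simp: external_field_def mono_on_def h_def)

lemma h_nonneg: "h r \<ge> 0"
proof (cases "0 < r")
  case True
  have "eventually (\<lambda>x. x \<in> {0<..<r}) (at_right 0)"
    using True by (intro eventually_at_right_real)
  then have "eventually (\<lambda>x. h x \<le> h r) (at_right 0)"
    by eventually_elim (auto intro: h_mono_pos)
  then show ?thesis
    using tendsto_upperbound[OF h_tendsto] by simp
qed (simp add: h_def)

lemma mono_h: "mono h"
proof (rule monoI)
  fix r s :: real assume "r \<le> s"
  then show "h r \<le> h s"
    using h_mono_pos[of r s] h_nonneg[of s] by (cases "0 < r") (auto simp: h_def[of r])
qed

lemma h_continuous_on: "continuous_on {0..a} h"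
proof (clarsimp simp: continuous_on_eq_continuous_within)
  fix x assume x: "0 \<le> x" "x \<le> a"
  show "continuous (at x within {0..a}) h"
  proof (cases "x = 0")
    case False
    with x have "isCont h x" using h_deriv[of x] DERIV_isCont by auto
    then show ?thesis by (rule continuous_at_imp_continuous_at_within)
  next
    case True
    have "(h \<longlongrightarrow> h 0) (at 0 within {0<..})" using h_tendsto by (simp add: h_def)
    then have "(h \<longlongrightarrow> h 0) (at 0 within {0..a})"
    proof (cases "a = 0")
      case True
      then show ?thesis by (simp add: at_within_def)
    next
      case False
      then show ?thesis using x \<open>x = 0\<close> \<open>(h \<longlongrightarrow> h 0) (at 0 within {0<..})\<close>
        by (simp add: at_within_Icc_at_right)
    qed
    then show ?thesis using True by (simp add: continuous_within)
  qed
qed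

lemma h'_nonneg:
  assumes "r > 0"
  shows "h' r \<ge> 0"
proof (rule ccontr)
  assume "\<not> ?thesis"
  then obtain d where d: "d > 0" "\<And>e. e > 0 \<Longrightarrow> e < d \<Longrightarrow> h (r + e) < h r"
    using DERIV_neg_dec_right[OF h_deriv[OF assms]] by auto
  from d(2)[of "d/2"] d(1) monoD[OF mono_h, of r "r + d/2"] show False by auto
qed

lemma deriv_g_nonneg: "r > 0 \<Longrightarrow> deriv g r \<ge> 0"
  using h_nonneg[of r] by (simp add: h_def zero_le_mult_iff)

lemma h_T: "h T = 2"
  using T_pos T_eq by (simp add: h_def)

lemma h_measurable [measurable]: "h \<in> borel_measurable borel"
  using mono_h by (rule borel_measurable_mono)

text \<open>The second derivative of \<open>g\<close> need not be continuous, but it is a limit of difference quotients.\<close>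
lemma rdens_measurable [measurable]: "rdens \<in> borel_measurable borel"
proof -
  define q where "q n r = (if 0 < r then ((h (r + 1 / real (Suc n)) - h r) / (1 / real (Suc n))) / (4 * pi * r) else 0)" for n r
  have [measurable]: "q n \<in> borel_measurable borel" for n
    unfolding q_def by measurable
  have "(\<lambda>n. q n r) \<longlonglongrightarrow> rdens r" for r
  proof (cases "0 < r")
    case True
    have "((\<lambda>e. (h (r + e) - h r) / e) \<longlongrightarrow> h' r) (at 0)"
      using h_deriv[OF True] by (simp add: DERIV_def)
    moreover have "filterlim (\<lambda>n. 1 / real (Suc n)) (at 0) sequentially"
      using LIMSEQ_Suc[OF lim_1_over_n[where 'a=real]] by (auto simp: filterlim_at)
    ultimately have "(\<lambda>n. (h (r + 1 / real (Suc n)) - h r) / (1 / real (Suc n))) \<longlonglongrightarrow> h' r"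
      by (rule filterlim_compose)
    then show ?thesis using True
      unfolding q_def rdens_def by (auto intro!: tendsto_intros simp del: of_nat_Suc)
  qed (simp add: q_def rdens_def)
  then show ?thesis by (rule borel_measurable_LIMSEQ_real) auto
qed

lemma field_measure_eq:
  assumes [measurable]: "A \<in> sets borel"
  shows "field_measure g A = density lborel (\<lambda>z. ennreal (rdens (cmod z)) * indicator A z)"
proof -
  let ?f = "\<lambda>z. if z \<in> A then ennreal (1 / (4 * pi) * (deriv (deriv g) (cmod z) + 1 / cmod z * deriv g (cmod z))) else 0"
  have eq: "?f z = (if z = 0 then ?f 0 else ennreal (rdens (cmod z)) * indicator A z)" for z
    by (auto simp: rdens_def h'_def field_simps)
  have [measurable]: "?f \<in> borel_measurable borel"
    by (subst eq) measurable
  show ?thesis unfolding field_measure_def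
  proof (rule density_cong)
    show "AE z in lborel. ?f z = ennreal (rdens (cmod z)) * indicator A z"
      using AE_lborel_singleton[of 0] by eventually_elim (subst eq, simp)
  qed measurable
qed

text \<open>The measure \<open>\<mu>\<^sub>1 + \<mu>\<^sub>2\<close>, which does not depend on \<open>U\<close>.\<close>
definition lam :: "complex measure" where
  "lam = density lborel (\<lambda>z. ennreal (rdens (cmod z)) * indicator (ball 0 T) z)"

lemma sets_lam [simp, measurable_cong]: "sets lam = sets borel"
  and space_lam [simp]: "space lam = UNIV"
  by (simp_all add: lam_def)

lemma lam_density_measurable [measurable]:
  "(\<lambda>z. ennreal (rdens (cmod z)) * indicator (ball 0 T) z) \<in> borel_measurable borel"
proof -
  have [measurable]: "ball (0::complex) T \<in> sets borel" by simp
  show ?thesis by measurable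
qed

lemma nn_integral_lam:
  "f \<in> borel_measurable borel \<Longrightarrow> (\<integral>\<^sup>+z. f z \<partial>lam) = (\<integral>\<^sup>+z. ennreal (rdens (cmod z)) * indicator (ball 0 T) z * f z \<partial>lborel)"
  unfolding lam_def by (subst nn_integral_density) auto

lemma nn_integral_lam_rotation:
  assumes c: "cmod c = 1" and [measurable]: "f \<in> borel_measurable borel"
  shows "(\<integral>\<^sup>+z. f (c * z) \<partial>lam) = (\<integral>\<^sup>+z. f z \<partial>lam)"
proof -
  have "(\<integral>\<^sup>+z. f z \<partial>lam) = (\<integral>\<^sup>+z. ennreal (rdens (cmod z)) * indicator (ball 0 T) z * f z \<partial>distr lborel borel ((*) c))"
    by (simp add: nn_integral_lam distr_lborel_rotation[OF c])
  also have "\<dots> = (\<integral>\<^sup>+z. ennreal (rdens (cmod (c * z))) * indicator (ball 0 T) (c * z) * f (c * z) \<partial>lborel)"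
    by (subst nn_integral_distr) measurable
  also have "\<dots> = (\<integral>\<^sup>+z. f (c * z) \<partial>lam)"
    using c by (subst nn_integral_lam) (auto simp: norm_mult indicator_def intro!: nn_integral_cong)
  finally show ?thesis ..
qed

lemma nn_integral_lam_radial:
  assumes [measurable]: "f \<in> borel_measurable borel"
  shows "(\<integral>\<^sup>+z. f (cmod z) \<partial>lam) = (\<integral>\<^sup>+r. ennreal (h' r / 2) * indicator {0<..<T} r * f r \<partial>lborel)"
proof -
  have "(\<integral>\<^sup>+z. f (cmod z) \<partial>lam) =
      (\<integral>\<^sup>+z. (\<lambda>r. ennreal (rdens r) * indicator {..<T} r * f r) (cmod z) \<partial>lborel)"
    by (subst nn_integral_lam) (auto simp: indicator_def intro!: nn_integral_cong)
  also have "\<dots> = (\<integral>\<^sup>+r. ennreal (2 * pi * r * indicator {0..} r) * (ennreal (rdens r) * indicator {..<T} r * f r) \<partial>lborel)"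
    by (rule nn_integral_radial) measurable
  also have "\<dots> = (\<integral>\<^sup>+r. ennreal (h' r / 2) * indicator {0<..<T} r * f r \<partial>lborel)"
  proof (rule nn_integral_cong)
    fix r :: real
    have "ennreal (2 * pi * r) * ennreal (rdens r) = ennreal (h' r / 2)" if "0 < r"
      using that by (subst ennreal_mult'[symmetric]) (auto simp: rdens_def)
    then show "ennreal (2 * pi * r * indicator {0..} r) * (ennreal (rdens r) * indicator {..<T} r * f r) =
      ennreal (h' r / 2) * indicator {0<..<T} r * f r"
      by (auto simp: indicator_def mult.assoc[symmetric])
  qed
  finally show ?thesis .
qed

text \<open>
  The fundamental theorem of calculus for the gauge integral applies to \<open>r g'(r)\<close> although its derivative may be
  discontinuous; integrability comes for free because this derivative is nonnegative.
\<close>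
lemma emeasure_lam_disc:
  assumes "0 \<le> t" "t \<le> T"
  shows "emeasure lam {w. cmod w \<le> t} = ennreal (h t / 2)"
proof -
  have "emeasure lam {w. cmod w \<le> t} = (\<integral>\<^sup>+z. indicator {..t} (cmod z) \<partial>lam)"
  proof -
    have "indicator {..t} (cmod z) = (indicator {w. cmod w \<le> t} z :: ennreal)" for z
      by (simp add: indicator_def)
    then show ?thesis by simp
  qed
  also have "\<dots> = (\<integral>\<^sup>+r. ennreal (h' r / 2) * indicator {0<..<T} r * indicator {..t} r \<partial>lborel)"
    by (rule nn_integral_lam_radial) measurable
  also have "\<dots> = (\<integral>\<^sup>+r. ennreal (if r = 0 then 0 else h' r / 2) * indicator {0..t} r \<partial>lborel)"
    by (rule nn_integral_cong_AE)
       (use AE_lborel_singleton[of T] in eventually_elim, use assms in \<open>auto simp: indicator_def\<close>)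
  also have "\<dots> = ennreal (h t / 2)"
  proof (rule nn_integral_has_integral_lebesgue')
    show "0 \<le> (if r = 0 then 0 else h' r / 2)" if "r \<in> {0..t}" for r
      using that h'_nonneg by auto
    have "(h' has_integral h t - h 0) {0..t}"
      using assms h_deriv
      by (intro fundamental_theorem_of_calculus_interior h_continuous_on)
         (auto simp: has_real_derivative_iff_has_vector_derivative)
    from has_integral_mult_right[OF this, of "1/2"]
    have "((\<lambda>r. h' r / 2) has_integral h t / 2) {0..t}" by (simp add: h_def[of 0])
    then show "((\<lambda>r. if r = 0 then 0 else h' r / 2) has_integral h t / 2) {0..t}"
      by (rule has_integral_spike[of "{0}", rotated 2]) auto
  qed
  finally show ?thesis .
qed

lemma AE_lam_less: "AE w in lam. cmod w < T"
  unfolding lam_def by (subst AE_density) (auto simp: indicator_def)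

lemma emeasure_lam_UNIV: "emeasure lam UNIV = 1"
proof -
  have "emeasure lam UNIV = emeasure lam {w. cmod w \<le> T}"
    by (rule emeasure_eq_AE) (use AE_lam_less in eventually_elim, auto)
  then show ?thesis using emeasure_lam_disc[of T] T_pos h_T by simp
qed

lemma prob_space_lam: "prob_space lam"
  by standard (simp add: emeasure_lam_UNIV)

text \<open>
  By rotation invariance, the kernel may be averaged over the rotations of \<open>w\<close> before it is integrated. Circles are
  \<open>\<lambda>\<close>-null, so the case \<open>|z| = |w|\<close>, in which the mean value formula is not available, does not matter.
\<close>
lemma log_pot_lam:
  assumes R: "T \<le> R" "2 * R \<le> M" and z: "cmod z \<le> R"
  shows "log_pot M lam z = (\<integral>\<^sup>+w. ennreal (ln (M / max (cmod z) (cmod w))) \<partial>lam)"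
proof -
  interpret lam: prob_space lam by (rule prob_space_lam)
  interpret p: pair_sigma_finite lam "lborel :: real measure" ..
  let ?e = "\<lambda>t::real. exp (2 * of_real pi * \<i> * of_real t)"
  have M: "M > 0" using R T_pos by linarith
  have e1: "cmod (?e t) = 1" for t by simp
  have "log_pot M lam z = (\<integral>\<^sup>+t. (\<integral>\<^sup>+w. log_ker M z w \<partial>lam) * indicator {0..1::real} t \<partial>lborel)"
    by (simp add: nn_integral_cmult log_pot_def)
  also have "\<dots> = (\<integral>\<^sup>+t. (\<integral>\<^sup>+w. log_ker M z (?e t * w) * indicator {0..1::real} t \<partial>lam) \<partial>lborel)"
    by (simp add: nn_integral_multc nn_integral_lam_rotation[OF e1, of "log_ker M z"])
  also have "\<dots> = (\<integral>\<^sup>+w. (\<integral>\<^sup>+t. log_ker M z (?e t * w) * indicator {0..1::real} t \<partial>lborel) \<partial>lam)"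
    by (rule p.Fubini') measurable
  also have "\<dots> = (\<integral>\<^sup>+w. ennreal (ln (M / max (cmod z) (cmod w))) \<partial>lam)"
  proof (rule nn_integral_cong_AE)
    have ne: "AE w in lam. cmod w \<noteq> cmod z"
    proof -
      have "negligible (sphere (0::complex) (cmod z))" by (rule negligible_sphere)
      then have "AE w in lborel. w \<notin> sphere (0::complex) (cmod z)"
        using AE_iff_null_sets[of "sphere (0::complex) (cmod z)" lborel]
        by (simp add: negligible_iff_null_sets null_sets_completion_iff)
      then show ?thesis unfolding lam_def by (subst AE_density) (auto elim: eventually_mono)
    qed
    show "AE w in lam. (\<integral>\<^sup>+t. log_ker M z (?e t * w) * indicator {0..1::real} t \<partial>lborel) = ennreal (ln (M / max (cmod z) (cmod w)))"
      using ne AE_lam_less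
    proof eventually_elim
      fix w assume w: "cmod w \<noteq> cmod z" "cmod w < T"
      have pos: "cmod (z - ?e t * w) > 0" for t
        using w e1[of t] by (metis eq_iff_diff_eq_0 mult_1 norm_mult zero_less_norm_iff)
      have le: "cmod (z - ?e t * w) \<le> M" for t
        using norm_triangle_ineq4[of z "?e t * w"] w z R by (simp add: norm_mult)
      have mx: "max (cmod z) (cmod w) > 0" using w by (metis less_max_iff_disj norm_ge_zero order_le_less)
      have "(\<integral>\<^sup>+t. log_ker M z (?e t * w) * indicator {0..1::real} t \<partial>lborel) =
          (\<integral>\<^sup>+t. ennreal (ln M - ln (cmod (z - ?e t * w))) * indicator {0..1::real} t \<partial>lborel)"
        using pos M by (intro nn_integral_cong) (auto simp: log_ker_def ln_div)
      also have "\<dots> = ennreal (ln M - ln (max (cmod z) (cmod w)))"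
      proof (rule nn_integral_has_integral_lebesgue')
        show "0 \<le> ln M - ln (cmod (z - ?e t * w))" for t using pos[of t] le[of t] M by simp
        have "((\<lambda>t::real. ln M) has_integral ln M) {0..1}"
          using has_integral_const_real[of "ln M" 0 1] by simp
        then show "((\<lambda>t. ln M - ln (cmod (z - ?e t * w))) has_integral ln M - ln (max (cmod z) (cmod w))) {0..1}"
          using w(1) by (intro has_integral_diff integral_ln_dist_circle) auto
      qed
      also have "ln M - ln (max (cmod z) (cmod w)) = ln (M / max (cmod z) (cmod w))"
        using mx M by (simp add: ln_div)
      finally show "(\<integral>\<^sup>+t. log_ker M z (?e t * w) * indicator {0..1::real} t \<partial>lborel) = ennreal (ln (M / max (cmod z) (cmod w)))" .
    qed
  qed
  finally show ?thesis .
qed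

lemma log_pot_lam_outside:
  assumes R: "T \<le> R" "2 * R \<le> M" and z: "T \<le> cmod z" "cmod z \<le> R"
  shows "log_pot M lam z = ennreal (ln (M / cmod z))"
proof -
  have "log_pot M lam z = (\<integral>\<^sup>+w. ennreal (ln (M / max (cmod z) (cmod w))) \<partial>lam)"
    by (rule log_pot_lam[OF R z(2)])
  also have "\<dots> = (\<integral>\<^sup>+w. ennreal (ln (M / cmod z)) \<partial>lam)"
    by (rule nn_integral_cong_AE) (use AE_lam_less in eventually_elim, use z in \<open>simp add: max_def\<close>)
  finally show ?thesis by (simp add: emeasure_lam_UNIV)
qed

text \<open>
  For \<open>s = |z|\<close>, the quantity \<open>log (T/max(s,|w|))\<close> is the integral of \<open>1/x\<close> over those \<open>x \<in> {s..T}\<close> with \<open>|w| \<le> x\<close>. By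
  Tonelli's theorem its \<open>\<lambda>\<close>-integral is the integral of \<open>\<lambda>{|w| \<le> x}/x = g'(x)/2\<close> over \<open>{s..T}\<close>.
\<close>
lemma log_pot_lam_inside:
  assumes R: "T \<le> R" "2 * R \<le> M" and z: "0 < cmod z" "cmod z \<le> T"
  shows "log_pot M lam z = ennreal (ln (M / T) + (g T - g (cmod z)) / 2)"
proof -
  define s where "s = cmod z"
  have s: "0 < s" "s \<le> T" using z by (auto simp: s_def)
  have M: "M > 0" "T \<le> M" using R T_pos by linarith+
  interpret lam: prob_space lam by (rule prob_space_lam)
  interpret p: pair_sigma_finite lam "lborel :: real measure" ..
  have "log_pot M lam z = (\<integral>\<^sup>+w. ennreal (ln (M / max s (cmod w))) \<partial>lam)"
    unfolding s_def using z R by (intro log_pot_lam) auto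
  also have "\<dots> = (\<integral>\<^sup>+w. ennreal (ln (M / T)) + (\<integral>\<^sup>+x. ennreal (1 / x) * indicator {s..T} x * indicator {w. cmod w \<le> x} w \<partial>lborel) \<partial>lam)"
  proof (rule nn_integral_cong_AE, use AE_lam_less in eventually_elim)
    fix w assume w: "cmod w < T"
    let ?m = "max s (cmod w)"
    have m: "0 < ?m" "?m \<le> T" using s w by auto
    have "(\<integral>\<^sup>+x. ennreal (1 / x) * indicator {s..T} x * indicator {w. cmod w \<le> x} w \<partial>lborel) =
        (\<integral>\<^sup>+x. ennreal (1 / x) * indicator {?m..T} x \<partial>lborel)"
      by (intro nn_integral_cong) (auto simp: indicator_def)
    also have "\<dots> = ennreal (ln T - ln ?m)"
      using m by (intro nn_integral_FTC_Icc) (auto intro!: derivative_eq_intros)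
    finally have "ennreal (ln (M / T)) + (\<integral>\<^sup>+x. ennreal (1 / x) * indicator {s..T} x * indicator {w. cmod w \<le> x} w \<partial>lborel) =
        ennreal (ln (M / T) + (ln T - ln ?m))"
      using m M T_pos by (subst ennreal_plus) auto
    also have "ln (M / T) + (ln T - ln ?m) = ln (M / ?m)"
      using m M T_pos by (simp add: ln_div)
    finally show "ennreal (ln (M / ?m)) = ennreal (ln (M / T)) + (\<integral>\<^sup>+x. ennreal (1 / x) * indicator {s..T} x * indicator {w. cmod w \<le> x} w \<partial>lborel)" ..
  qed
  also have "\<dots> = ennreal (ln (M / T)) + (\<integral>\<^sup>+w. (\<integral>\<^sup>+x. ennreal (1 / x) * indicator {s..T} x * indicator {w. cmod w \<le> x} w \<partial>lborel) \<partial>lam)"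
    by (subst nn_integral_add) (auto simp: emeasure_lam_UNIV)
  also have "(\<integral>\<^sup>+w. (\<integral>\<^sup>+x. ennreal (1 / x) * indicator {s..T} x * indicator {w. cmod w \<le> x} w \<partial>lborel) \<partial>lam) =
      (\<integral>\<^sup>+x. (\<integral>\<^sup>+w. ennreal (1 / x) * indicator {s..T} x * indicator {w. cmod w \<le> x} w \<partial>lam) \<partial>lborel)"
    by (rule p.Fubini'[symmetric]) measurable
  also have "\<dots> = (\<integral>\<^sup>+x. ennreal (deriv g x / 2) * indicator {s..T} x \<partial>lborel)"
  proof (rule nn_integral_cong)
    fix x :: real
    have "(\<integral>\<^sup>+w. ennreal (1 / x) * indicator {s..T} x * indicator {w. cmod w \<le> x} w \<partial>lam) =
        ennreal (1 / x) * indicator {s..T} x * emeasure lam {w. cmod w \<le> x}"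
      by (subst nn_integral_cmult) auto
    also have "\<dots> = ennreal (deriv g x / 2) * indicator {s..T} x"
    proof (cases "x \<in> {s..T}")
      case True
      then have "ennreal (1 / x) * ennreal (h x / 2) = ennreal (deriv g x / 2)"
        using s by (subst ennreal_mult'[symmetric]) (auto simp: h_def)
      then show ?thesis using True s by (simp add: emeasure_lam_disc)
    qed simp
    finally show "(\<integral>\<^sup>+w. ennreal (1 / x) * indicator {s..T} x * indicator {w. cmod w \<le> x} w \<partial>lam) = ennreal (deriv g x / 2) * indicator {s..T} x" .
  qed
  also have "\<dots> = ennreal ((g T - g s) / 2)"
  proof (rule nn_integral_has_integral_lebesgue')
    show "0 \<le> deriv g x / 2" if "x \<in> {s..T}" for x
      using that s deriv_g_nonneg by auto
    have "(deriv g has_integral g T - g s) {s..T}"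
    proof (rule fundamental_theorem_of_calculus)
      show "(g has_vector_derivative deriv g x) (at x within {s..T})" if "x \<in> {s..T}" for x
        using that s g_deriv[of x]
        by (auto simp: has_real_derivative_iff_has_vector_derivative intro: has_vector_derivative_at_within)
    qed (use s in auto)
    from has_integral_mult_right[OF this, of "1/2"]
    show "((\<lambda>x. deriv g x / 2) has_integral (g T - g s) / 2) {s..T}" by simp
  qed
  also have "ennreal (ln (M / T)) + ennreal ((g T - g s) / 2) = ennreal (ln (M / T) + (g T - g s) / 2)"
    using s M T_pos g_mono[of s T] by (intro ennreal_plus[symmetric]) auto
  finally show ?thesis by (simp add: s_def)
qed

text \<open>Since \<open>r g'(r) \<ge> 2\<close> for \<open>r \<ge> T\<close>, the function \<open>g - 2 log\<close> is increasing there.\<close>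
lemma g_growth:
  assumes "T \<le> s"
  shows "g T + 2 * ln (s / T) \<le> g s"
proof -
  have "g T - 2 * ln T \<le> g s - 2 * ln s"
  proof (rule DERIV_nonneg_imp_nondecreasing[OF assms])
    fix x assume x: "T \<le> x" "x \<le> s"
    then have "h x \<ge> 2" using monoD[OF mono_h x(1)] h_T by simp
    then have "deriv g x - 2 / x \<ge> 0" using x T_pos by (simp add: h_def field_simps)
    moreover have "((\<lambda>x. g x - 2 * ln x) has_real_derivative (deriv g x - 2 / x)) (at x)"
      using x T_pos g_deriv[of x] by (auto intro!: derivative_eq_intros)
    ultimately show "\<exists>y. ((\<lambda>x. g x - 2 * ln x) has_real_derivative y) (at x) \<and> 0 \<le> y" by blast
  qed
  then show ?thesis using assms T_pos by (simp add: ln_div)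
qed

lemma log_pot_lam_ge:
  assumes R: "T \<le> R" "2 * R \<le> M" and z: "z \<noteq> 0" "cmod z \<le> R"
  shows "ennreal (ln (M / T) + g T / 2) \<le> log_pot M lam z + ennreal (g (cmod z) / 2)"
proof (cases "cmod z \<le> T")
  case True
  have M: "M > 0" "T \<le> M" using R T_pos by linarith+
  have "log_pot M lam z + ennreal (g (cmod z) / 2) = ennreal (ln (M / T) + (g T - g (cmod z)) / 2 + g (cmod z) / 2)"
    using True z M T_pos g_mono[of "cmod z" T] g_nonneg[of "cmod z"]
    by (subst ennreal_plus) (auto simp: log_pot_lam_inside[OF R])
  then show ?thesis by (simp add: diff_divide_distrib)
next
  case False
  have M: "M > 0" "T \<le> M" "cmod z \<le> M" using R T_pos z by linarith+
  have pos: "cmod z > 0" using z by simp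
  have "ln (M / T) + g T / 2 \<le> ln (M / cmod z) + g (cmod z) / 2"
    using g_growth[of "cmod z"] False M pos T_pos by (simp add: ln_div)
  also have "ennreal \<dots> = log_pot M lam z + ennreal (g (cmod z) / 2)"
    using False z M pos g_nonneg[of "cmod z"]
    by (subst ennreal_plus) (auto simp: log_pot_lam_outside[OF R])
  finally show ?thesis using ennreal_leI by blast
qed

end

section \<open>Characterization of the equilibrium measure\<close>

lemma space_add_measure [simp]: "space (add_measure M N) = space M"
  by (rule sets_eq_imp_space_eq) simp

lemma nn_integral_add_measure:
  assumes N: "sets N = sets M" and f: "f \<in> borel_measurable M"
  shows "(\<integral>\<^sup>+x. f x \<partial>add_measure M N) = (\<integral>\<^sup>+x. f x \<partial>M) + (\<integral>\<^sup>+x. f x \<partial>N)"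
  using f
proof (induction rule: borel_measurable_induct)
  case (cong f g)
  have "(\<integral>\<^sup>+x. f x \<partial>L) = (\<integral>\<^sup>+x. g x \<partial>L)" if "space L = space M" for L
    by (rule nn_integral_cong) (simp add: that cong(3))
  then show ?case using cong(4) sets_eq_imp_space_eq[OF N] by simp
next
  case (set A)
  then show ?case using N by (simp add: emeasure_add_measure)
next
  case (mult u c)
  have [measurable]: "u \<in> borel_measurable (add_measure M N)" "u \<in> borel_measurable N"
    using mult(2) N by (auto cong: measurable_cong_sets)
  show ?case using mult by (simp add: nn_integral_cmult distrib_left)
next
  case (add u v)
  have [measurable]: "u \<in> borel_measurable (add_measure M N)" "u \<in> borel_measurable N"
    "v \<in> borel_measurable (add_measure M N)" "v \<in> borel_measurable N"
    using add N by (auto cong: measurable_cong_sets)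
  show ?case using add by (simp add: nn_integral_add ac_simps)
next
  case (seq u)
  have m: "u i \<in> borel_measurable (add_measure M N)" "u i \<in> borel_measurable N" for i
    using seq(1)[of i] N by (auto cong: measurable_cong_sets)
  have mono: "mono (\<lambda>i. integral\<^sup>N L (u i))" for L
    using seq by (intro monoI nn_integral_mono) (auto simp: incseq_def le_fun_def)
  have conv: "(\<integral>\<^sup>+x. (SUP i. u i) x \<partial>L) = (SUP i. \<integral>\<^sup>+x. u i x \<partial>L)"
    if "\<And>i. u i \<in> borel_measurable L" for L
    unfolding SUP_apply using seq(3) that by (rule nn_integral_monotone_convergence_SUP)
  have "(\<integral>\<^sup>+x. (SUP i. u i) x \<partial>add_measure M N) = (SUP i. (\<integral>\<^sup>+x. u i x \<partial>M) + (\<integral>\<^sup>+x. u i x \<partial>N))"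
    unfolding conv[OF m(1)] by (simp only: seq)
  also have "\<dots> = (SUP i. \<integral>\<^sup>+x. u i x \<partial>M) + (SUP i. \<integral>\<^sup>+x. u i x \<partial>N)"
    by (rule ennreal_SUP_add) (use mono in auto)
  also have "\<dots> = (\<integral>\<^sup>+x. (SUP i. u i) x \<partial>M) + (\<integral>\<^sup>+x. (SUP i. u i) x \<partial>N)"
    by (simp only: conv[OF seq(1)] conv[OF m(2)])
  finally show ?case .
qed

lemma nn_integral_add_cmult:
  assumes [measurable]: "u \<in> borel_measurable M" "v \<in> borel_measurable M"
  shows "(\<integral>\<^sup>+x. u x + c * v x \<partial>M) = (\<integral>\<^sup>+x. u x \<partial>M) + c * (\<integral>\<^sup>+x. v x \<partial>M)"
  by (simp add: nn_integral_add nn_integral_cmult)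

lemma disc_measure_mono: "disc_measure R \<sigma> \<Longrightarrow> R \<le> R' \<Longrightarrow> disc_measure R' \<sigma>"
  by (auto simp: disc_measure_def elim: eventually_mono)

context admissible_field
begin

lemma g_cmod_measurable [measurable]: "(\<lambda>z. g (cmod z)) \<in> borel_measurable borel"
proof -
  have "mono (\<lambda>r. g (max 0 r))" by (rule monoI) (auto intro: g_mono)
  then have [measurable]: "(\<lambda>r. g (max 0 r)) \<in> borel_measurable borel" by (rule borel_measurable_mono)
  have "(\<lambda>z. g (max 0 (cmod z))) \<in> borel_measurable borel" by measurable
  then show ?thesis by simp
qed

text \<open>The integral of the external field against \<open>\<sigma>\<close>.\<close>
definition field_int :: "complex measure \<Rightarrow> ennreal" where
  "field_int \<sigma> = (\<integral>\<^sup>+z. ennreal (g (cmod z)) \<partial>\<sigma>)"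

lemma field_int_finite:
  assumes \<sigma>: "disc_measure R \<sigma>"
  shows "field_int \<sigma> < \<infinity>"
proof -
  interpret finite_measure \<sigma> by (rule disc_measureD[OF \<sigma>])
  have "field_int \<sigma> \<le> (\<integral>\<^sup>+z. ennreal (g R) \<partial>\<sigma>)"
    unfolding field_int_def
    by (rule nn_integral_mono_AE) (use disc_measureD(4)[OF \<sigma>] in eventually_elim, auto intro!: ennreal_leI g_mono)
  also have "\<dots> < \<infinity>" by (simp add: emeasure_eq_measure ennreal_mult_less_top)
  finally show ?thesis .
qed

lemma weighted_energy_eq:
  assumes \<sigma>: "disc_measure R \<sigma>" "prob_space \<sigma>" and M: "2 * R \<le> M" "1 \<le> M"
  shows "weighted_energy g \<sigma> = enn2ereal (mutual_energy M \<sigma> \<sigma>) - ereal (ln M) + enn2ereal (field_int \<sigma>)"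
proof -
  have "measure \<sigma> UNIV = 1"
    using prob_space.prob_space[OF \<sigma>(2)] disc_measureD(3)[OF \<sigma>(1)] by simp
  moreover have "eintegral \<sigma> (\<lambda>z. ereal (g (cmod z))) = enn2ereal (field_int \<sigma>)"
    by (simp add: eintegral_def field_int_def e2ennreal_ereal ennreal_neg g_nonneg zero_ennreal.rep_eq)
  ultimately show ?thesis
    by (simp add: weighted_energy_def log_energy_eq[OF \<sigma>(1) M])
qed

lemma disc_measure_lam: "disc_measure T lam"
  using AE_lam_less prob_space_lam
  by (auto simp: disc_measure_def prob_space_def elim: eventually_mono)

lemma lam_polar_null:
  assumes N: "N \<in> sets borel" "polar N"
  shows "emeasure lam N = 0"
proof -
  define M where "M = max 1 (2 * T)"
  have M: "2 * T \<le> M" "1 \<le> M" by (auto simp: M_def)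
  interpret lam: prob_space lam by (rule prob_space_lam)
  have "mutual_energy M lam lam \<le> (\<integral>\<^sup>+z. ennreal (ln (M / T) + g T / 2) \<partial>lam)"
    unfolding mutual_energy_def
  proof (rule nn_integral_mono_AE)
    have "AE z in lam. z \<noteq> 0"
      unfolding lam_def using AE_lborel_singleton[of "0::complex"]
      by (subst AE_density) (measurable, auto elim: eventually_mono)
    then show "AE z in lam. log_pot M lam z \<le> ennreal (ln (M / T) + g T / 2)"
      using AE_lam_less
    proof eventually_elim
      fix z assume "z \<noteq> 0" "cmod z < T"
      then show "log_pot M lam z \<le> ennreal (ln (M / T) + g T / 2)"
        using M g_nonneg[of "cmod z"] by (subst log_pot_lam_inside[of T M]) (auto intro!: ennreal_leI)
    qed
  qed
  also have "\<dots> < \<infinity>" by (simp add: emeasure_lam_UNIV)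
  finally show ?thesis
    using finite_energy_polar_null[OF disc_measure_lam M _ N] by blast
qed

end

text \<open>
  A probability measure on \<open>- U\<close> that does not charge Borel polar sets and whose potential agrees with that of \<open>lam\<close>
  outside \<open>U\<close> and a Borel polar set \<open>N\<close>. These properties determine the equilibrium measure. The disc of radius \<open>R\<close> and
  the constant \<open>M\<close> remain free, since they have to be adapted to the competing measures.
\<close>
locale equilibrium_candidate = admissible_field +
  fixes U :: "complex set" and \<nu> :: "complex measure" and N :: "complex set"
  assumes open_U: "open U"
    and prob_\<nu>: "prob_space \<nu>" and disc_\<nu>: "disc_measure T \<nu>" and \<nu>_U: "emeasure \<nu> U = 0"
    and \<nu>_polar: "\<And>B. B \<in> sets borel \<Longrightarrow> polar B \<Longrightarrow> emeasure \<nu> B = 0"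
    and N: "N \<in> sets borel" "polar N"
    and pot: "\<And>z R M. z \<notin> U \<Longrightarrow> z \<notin> N \<Longrightarrow> T \<le> R \<Longrightarrow> 2 * R \<le> M \<Longrightarrow> 1 \<le> M \<Longrightarrow> cmod z \<le> R \<Longrightarrow>
      log_pot M \<nu> z = log_pot M lam z"
begin

lemma borel_prob_\<nu>: "borel_prob \<nu>"
  using prob_\<nu> disc_measureD(2)[OF disc_\<nu>] by (simp add: borel_prob_def borel_prob_axioms_def)

lemma AE_good:
  assumes "sets \<sigma> = sets borel" "emeasure \<sigma> U = 0" "\<And>B. B \<in> sets borel \<Longrightarrow> polar B \<Longrightarrow> emeasure \<sigma> B = 0"
  shows "AE z in \<sigma>. z \<notin> U \<and> z \<notin> N \<and> z \<noteq> 0"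
proof -
  have "U \<union> N \<union> {0} \<in> null_sets \<sigma>"
    using assms N open_U polar_singleton[of 0]
    by (intro null_sets.Un) (auto simp: null_sets_def)
  then show ?thesis using AE_not_in[of "U \<union> N \<union> {0}" \<sigma>] by simp
qed

lemma AE_good_\<nu>: "AE z in \<nu>. z \<notin> U \<and> z \<notin> N \<and> z \<noteq> 0"
  by (rule AE_good[OF disc_measureD(2)[OF disc_\<nu>] \<nu>_U]) (rule \<nu>_polar)

lemma \<nu>_compact_probs: "\<nu> \<in> compact_probs (- U)"
proof -
  have null: "AE z in \<nu>. z \<in> cball 0 T \<inter> - U"
    using disc_measureD(4)[OF disc_\<nu>] AE_good_\<nu> by eventually_elim auto
  have cl: "closed (cball 0 T \<inter> - U)" using open_U by auto
  have "- (cball 0 T \<inter> - U) \<in> sets \<nu>"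
    unfolding disc_measureD(2)[OF disc_\<nu>] by (intro borel_comp borel_closed cl)
  moreover have "AE z in \<nu>. z \<notin> - (cball 0 T \<inter> - U)" using null by eventually_elim simp
  ultimately have "emeasure \<nu> (- (cball 0 T \<inter> - U)) = 0"
    using AE_iff_null_sets null_setsD1 by blast
  then have sub: "msupport \<nu> \<subseteq> cball 0 T \<inter> - U"
    by (rule msupport_subset_closed[OF cl])
  have "compact (msupport \<nu>)"
    using sub closed_msupport[of \<nu>] bounded_subset[OF bounded_cball[of 0 T]] by (auto simp: compact_eq_bounded_closed)
  then show ?thesis using sub prob_\<nu> disc_measureD(2)[OF disc_\<nu>] by (auto simp: compact_probs_def)
qed

text \<open>The relation \<open>p + g/2 = F\<close>, integrated against \<open>\<nu>\<close>; the kernel with parameter \<open>M\<close> adds \<open>log M\<close> to \<open>F\<close>.\<close>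
lemma \<nu>_energy:
  assumes R: "T \<le> R" "2 * R \<le> M" "1 \<le> M"
  shows "mutual_energy M \<nu> \<nu> + ennreal (1/2) * field_int \<nu> = ennreal (ln (M / T) + g T / 2)"
proof -
  interpret \<nu>: borel_prob \<nu> by (rule borel_prob_\<nu>)
  note [measurable] = log_pot_measurable[OF disc_\<nu>]
  have "mutual_energy M \<nu> \<nu> + ennreal (1/2) * field_int \<nu> = (\<integral>\<^sup>+z. log_pot M \<nu> z + ennreal (1/2) * ennreal (g (cmod z)) \<partial>\<nu>)"
    unfolding mutual_energy_def field_int_def
    by (rule nn_integral_add_cmult[symmetric]) measurable
  also have "\<dots> = (\<integral>\<^sup>+z. ennreal (ln (M / T) + g T / 2) \<partial>\<nu>)"
  proof (rule nn_integral_cong_AE)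
    show "AE z in \<nu>. log_pot M \<nu> z + ennreal (1/2) * ennreal (g (cmod z)) = ennreal (ln (M / T) + g T / 2)"
      using disc_measureD(4)[OF disc_\<nu>] AE_good_\<nu>
    proof eventually_elim
      fix z assume z: "cmod z \<le> T" "z \<notin> U \<and> z \<notin> N \<and> z \<noteq> 0"
      have "log_pot M \<nu> z = ennreal (ln (M / T) + (g T - g (cmod z)) / 2)"
        using z R pot[of z R M] log_pot_lam_inside[of R M z] by auto
      moreover have "ennreal (1/2) * ennreal (g (cmod z)) = ennreal (g (cmod z) / 2)"
        by (subst ennreal_mult'[symmetric]) auto
      moreover have "0 \<le> ln (M / T) + (g T - g (cmod z)) / 2"
        using z R T_pos g_mono[of "cmod z" T] by (intro add_nonneg_nonneg) auto
      ultimately show "log_pot M \<nu> z + ennreal (1/2) * ennreal (g (cmod z)) = ennreal (ln (M / T) + g T / 2)"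
        using g_nonneg[of "cmod z"] by (simp add: ennreal_plus[symmetric] diff_divide_distrib del: ennreal_plus)
    qed
  qed
  also have "\<dots> = ennreal (ln (M / T) + g T / 2)" using \<nu>.emeasure_space_1 by simp
  finally show ?thesis .
qed

text \<open>The relation \<open>p + g/2 \<ge> F\<close>, integrated against a competitor of finite energy.\<close>
lemma \<nu>_mutual:
  assumes R: "T \<le> R" "2 * R \<le> M" "1 \<le> M" and \<mu>: "disc_measure R \<mu>" "prob_space \<mu>" "emeasure \<mu> U = 0"
    and fin: "mutual_energy M \<mu> \<mu> < \<infinity>"
  shows "ennreal (ln (M / T) + g T / 2) \<le> mutual_energy M \<mu> \<nu> + ennreal (1/2) * field_int \<mu>"
proof -
  interpret \<mu>: prob_space \<mu> by fact
  note [measurable_cong] = disc_measureD(2)[OF \<mu>(1)]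
  note [measurable] = log_pot_measurable[OF disc_\<nu>]
  have good: "AE z in \<mu>. z \<notin> U \<and> z \<notin> N \<and> z \<noteq> 0"
    using disc_measureD(2)[OF \<mu>(1)] \<mu>(3)
    by (rule AE_good) (rule finite_energy_polar_null[OF \<mu>(1) R(2,3) fin])
  have "ennreal (ln (M / T) + g T / 2) = (\<integral>\<^sup>+z. ennreal (ln (M / T) + g T / 2) \<partial>\<mu>)"
    using \<mu>.emeasure_space_1 by simp
  also have "\<dots> \<le> (\<integral>\<^sup>+z. log_pot M \<nu> z + ennreal (1/2) * ennreal (g (cmod z)) \<partial>\<mu>)"
  proof (rule nn_integral_mono_AE)
    show "AE z in \<mu>. ennreal (ln (M / T) + g T / 2) \<le> log_pot M \<nu> z + ennreal (1/2) * ennreal (g (cmod z))"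
      using disc_measureD(4)[OF \<mu>(1)] good
    proof eventually_elim
      fix z assume z: "cmod z \<le> R" "z \<notin> U \<and> z \<notin> N \<and> z \<noteq> 0"
      have "log_pot M \<nu> z = log_pot M lam z" using z R pot by auto
      moreover have "ennreal (1/2) * ennreal (g (cmod z)) = ennreal (g (cmod z) / 2)"
        by (subst ennreal_mult'[symmetric]) auto
      ultimately show "ennreal (ln (M / T) + g T / 2) \<le> log_pot M \<nu> z + ennreal (1/2) * ennreal (g (cmod z))"
        using log_pot_lam_ge[of R M z] z R by simp
    qed
  qed
  also have "\<dots> = mutual_energy M \<mu> \<nu> + ennreal (1/2) * field_int \<mu>"
    unfolding mutual_energy_def field_int_def
    by (rule nn_integral_add_cmult) measurable
  finally show ?thesis .
qed

lemma weighted_energy_\<nu>: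
  "weighted_energy g \<nu> = ereal (g T / 2 - ln T + enn2real (field_int \<nu>) / 2)"
proof -
  define M where "M = max 1 (2 * T)"
  have M: "2 * T \<le> M" "1 \<le> M" by (auto simp: M_def)
  have F: "ln (M / T) + g T / 2 \<ge> 0" using M T_pos g_nonneg[of T] by auto
  obtain j where j: "field_int \<nu> = ennreal j" "j \<ge> 0"
    using field_int_finite[OF disc_\<nu>] by (cases "field_int \<nu>") auto
  obtain b where b: "mutual_energy M \<nu> \<nu> = ennreal b" "b \<ge> 0"
    using \<nu>_energy[OF order_refl M] by (cases "mutual_energy M \<nu> \<nu>") auto
  have "ennreal (b + j / 2) = mutual_energy M \<nu> \<nu> + ennreal (1/2) * field_int \<nu>"
    using b j by (simp add: ennreal_plus ennreal_mult'[symmetric] del: ennreal_half)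
  also have "\<dots> = ennreal (ln (M / T) + g T / 2)" by (rule \<nu>_energy[OF order_refl M])
  finally have "b + j / 2 = ln (M / T) + g T / 2" using b j F by (subst (asm) ennreal_inj) auto
  then have "b = ln M - ln T + g T / 2 - j / 2" using M T_pos by (simp add: ln_div)
  then show ?thesis
    using weighted_energy_eq[OF disc_\<nu> prob_\<nu> M] b j by (simp add: enn2ereal_ennreal)
qed

lemma weighted_energy_less:
  assumes \<mu>: "\<mu> \<in> compact_probs (- U)" and ne: "\<mu> \<noteq> \<nu>"
  shows "weighted_energy g \<nu> < weighted_energy g \<mu>"
proof -
  have P: "prob_space \<mu>" "sets \<mu> = sets borel" "compact (msupport \<mu>)" "msupport \<mu> \<subseteq> - U"
    using \<mu> by (auto simp: compact_probs_def)
  interpret \<mu>: borel_prob \<mu> using P by (simp add: borel_prob_def borel_prob_axioms_def)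
  obtain R0 where R0: "\<And>z. z \<in> msupport \<mu> \<Longrightarrow> cmod z \<le> R0"
    using compact_imp_bounded[OF P(3)] by (auto simp: bounded_iff)
  define R where "R = max R0 T"
  define M where "M = max 1 (2 * R)"
  have R: "T \<le> R" "2 * R \<le> M" "1 \<le> M" by (auto simp: M_def R_def)
  have M0: "M > 0" using R by simp
  have null: "emeasure \<mu> (- msupport \<mu>) = 0" using P by (intro emeasure_compl_msupport)
  have "AE z in \<mu>. z \<in> msupport \<mu>"
    using AE_iff_null_sets[of "- msupport \<mu>" \<mu>] null closed_msupport[of \<mu>] by (simp add: null_sets_def)
  then have ae: "AE z in \<mu>. cmod z \<le> R"
    by eventually_elim (use R0 in \<open>force simp: R_def\<close>)
  then have disc: "disc_measure R \<mu>"
    using P \<mu>.finite_measure_axioms by (simp add: disc_measure_def)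
  have disc\<nu>: "disc_measure R \<nu>" using disc_measure_mono[OF disc_\<nu>] R by simp
  have "emeasure \<mu> U \<le> emeasure \<mu> (- msupport \<mu>)"
    using P(4) closed_msupport[of \<mu>] by (intro emeasure_mono) auto
  then have \<mu>U: "emeasure \<mu> U = 0" using null by simp
  note W = weighted_energy_eq[OF disc P(1) R(2,3)]
  show ?thesis
  proof (cases "mutual_energy M \<mu> \<mu> < \<infinity>")
    case False
    then have "weighted_energy g \<mu> = \<infinity>" using W by (simp add: less_top[symmetric])
    then show ?thesis by (simp add: weighted_energy_\<nu>)
  next
    case True
    define q where "q = ennreal (2 / pi) * (\<integral>\<^sup>+t. indicator {0<..} t * gauss_dist t \<mu> \<nu> \<partial>lborel)"
    have q0: "q \<noteq> 0"
      using gauss_dist_eq_0_imp_eq[OF \<mu>.borel_prob_axioms borel_prob_\<nu>] ne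
      by (auto simp: q_def ennreal_eq_0_iff not_le)
    have par: "mutual_energy M \<mu> \<mu> + mutual_energy M \<nu> \<nu> = 2 * mutual_energy M \<mu> \<nu> + q"
      unfolding q_def using ae disc_measureD(4)[OF disc\<nu>] R M0
      by (intro mutual_energy_parallelogram[OF \<mu>.borel_prob_axioms _ borel_prob_\<nu>]) auto
    define F where "F = ln (M / T) + g T / 2"
    have F: "F \<ge> 0" "F = ln M - ln T + g T / 2"
      using R T_pos g_nonneg[of T] by (auto simp: F_def ln_div)
    obtain j k where j: "field_int \<nu> = ennreal j" "j \<ge> 0" and k: "field_int \<mu> = ennreal k" "k \<ge> 0"
      using field_int_finite[OF disc_\<nu>] field_int_finite[OF disc]
      by (cases "field_int \<nu>"; cases "field_int \<mu>") auto
    obtain a where a: "mutual_energy M \<mu> \<mu> = ennreal a" "a \<ge> 0"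
      using True by (cases "mutual_energy M \<mu> \<mu>") auto
    obtain b where b: "mutual_energy M \<nu> \<nu> = ennreal b" "b \<ge> 0"
      using \<nu>_energy[OF R] by (cases "mutual_energy M \<nu> \<nu>") auto
    obtain c where c: "mutual_energy M \<mu> \<nu> = ennreal c" "c \<ge> 0"
      using par a b by (cases "mutual_energy M \<mu> \<nu>") (auto simp: ennreal_mult_top)
    obtain p where p: "q = ennreal p" "p > 0"
      using par a b q0 by (cases q) (auto simp: ennreal_eq_0_iff)
    have "ennreal (a + b) = ennreal (2 * c + p)"
      using par a b c p by (simp add: ennreal_plus ennreal_mult')
    then have 1: "a + b = 2 * c + p" using a b c p by (subst (asm) ennreal_inj) auto
    have "ennreal (b + j / 2) = ennreal F"
      using \<nu>_energy[OF R] b j by (simp add: F_def ennreal_plus ennreal_mult'[symmetric] del: ennreal_half)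
    then have 2: "b + j / 2 = F" using b j F by (subst (asm) ennreal_inj) auto
    have "ennreal F \<le> ennreal (c + k / 2)"
      using \<nu>_mutual[OF R disc P(1) \<mu>U True] c k by (simp add: F_def ennreal_plus ennreal_mult'[symmetric] del: ennreal_half)
    then have 3: "F \<le> c + k / 2" using c k F by (subst (asm) ennreal_le_iff) auto
    have "weighted_energy g \<mu> = ereal (a - ln M + k)"
      using W a k by (simp add: enn2ereal_ennreal)
    moreover have "g T / 2 - ln T + j / 2 < a - ln M + k"
      using 1 2 3 p F(2) by linarith
    ultimately show ?thesis using j by (simp add: weighted_energy_\<nu>)
  qed
qed

lemma is_equilibrium: "is_equilibrium_measure g (- U) \<nu>"
  unfolding is_equilibrium_measure_def is_arg_min_def
  using \<nu>_compact_probs weighted_energy_less by (metis less_asym)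

lemma min_energy_eq: "min_energy g U = ereal (g T / 2 - ln T + enn2real (field_int \<nu>) / 2)"
proof -
  have "min_energy g U = weighted_energy g \<nu>"
    unfolding min_energy_def
  proof (rule antisym)
    show "(INF \<mu>\<in>compact_probs (- U). weighted_energy g \<mu>) \<le> weighted_energy g \<nu>"
      using \<nu>_compact_probs by (rule INF_lower)
    show "weighted_energy g \<nu> \<le> (INF \<mu>\<in>compact_probs (- U). weighted_energy g \<mu>)"
      by (rule INF_greatest) (metis order_le_less weighted_energy_less)
  qed
  then show ?thesis by (simp add: weighted_energy_\<nu>)
qed

end

theorem theorem2p6:
  fixes g :: "real \<Rightarrow> real" and T :: real and U :: "complex set"
    and \<mu>\<^sub>1 \<mu>\<^sub>2 \<nu>\<^sub>2 :: "complex measure"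
  assumes "external_field g"
    and "T > 0" and "T * deriv g T = 2"
    and "open U" and "U \<subseteq> ball 0 T"
    and "\<mu>\<^sub>1 = field_measure g (ball 0 T - U)"
    and "\<mu>\<^sub>2 = field_measure g U"
    and "is_balayage U \<mu>\<^sub>2 \<nu>\<^sub>2"
  shows "is_equilibrium_measure g (- U) (add_measure \<mu>\<^sub>1 \<nu>\<^sub>2) \<and>
    min_energy g U = min_energy g {} +
      ereal (1 / 2 * ((LINT z:frontier U|\<nu>\<^sub>2. g (cmod z)) - (LINT z:U|\<mu>\<^sub>2. g (cmod z))))"
proof -
  interpret admissible_field g T using assms by unfold_locales
  interpret lam: prob_space lam by (rule prob_space_lam)
  have U [measurable]: "U \<in> sets borel" "ball 0 T - U \<in> sets borel" "frontier U \<in> sets borel"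
    using \<open>open U\<close> by auto
  have \<mu>1: "\<mu>\<^sub>1 = density lborel (\<lambda>z. ennreal (rdens (cmod z)) * indicator (ball 0 T - U) z)"
    unfolding assms(6) by (rule field_measure_eq) measurable
  have \<mu>2: "\<mu>\<^sub>2 = density lborel (\<lambda>z. ennreal (rdens (cmod z)) * indicator U z)"
    unfolding assms(7) by (rule field_measure_eq) measurable
  have [simp, measurable_cong]: "sets \<mu>\<^sub>1 = sets borel" "sets \<mu>\<^sub>2 = sets borel"
    by (simp_all add: \<mu>1 \<mu>2)
  have bal: "sets \<nu>\<^sub>2 = sets borel" "emeasure \<nu>\<^sub>2 (- frontier U) = 0" "emeasure \<nu>\<^sub>2 (frontier U) = emeasure \<mu>\<^sub>2 U"
    "\<And>B. B \<in> sets borel \<Longrightarrow> polar B \<Longrightarrow> emeasure \<nu>\<^sub>2 B = 0"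
    "quasi_everywhere (- U) (\<lambda>z. potential \<nu>\<^sub>2 z = potential \<mu>\<^sub>2 z)"
    using assms(8) by (auto simp: is_balayage_def)
  note [simp, measurable_cong] = bal(1)
  \<comment> \<open>As \<open>U\<close> lies in the disc, \<open>\<mu>\<^sub>1 + \<mu>\<^sub>2 = lam\<close>.\<close>
  have split: "(\<integral>\<^sup>+z. f z \<partial>\<mu>\<^sub>1) + (\<integral>\<^sup>+z. f z \<partial>\<mu>\<^sub>2) = (\<integral>\<^sup>+z. f z \<partial>lam)" if [measurable]: "f \<in> borel_measurable borel" for f
  proof -
    have "(\<integral>\<^sup>+z. f z \<partial>\<mu>\<^sub>1) + (\<integral>\<^sup>+z. f z \<partial>\<mu>\<^sub>2) =
      (\<integral>\<^sup>+z. ennreal (rdens (cmod z)) * indicator (ball 0 T - U) z * f z + ennreal (rdens (cmod z)) * indicator U z * f z \<partial>lborel)"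
      unfolding \<mu>1 \<mu>2 by (simp add: nn_integral_density nn_integral_add)
    also have "\<dots> = (\<integral>\<^sup>+z. f z \<partial>lam)"
      unfolding nn_integral_lam[OF that]
      using assms(5) by (intro nn_integral_cong) (auto simp: indicator_def)
    finally show ?thesis .
  qed
  have em: "emeasure \<mu>\<^sub>1 A + emeasure \<mu>\<^sub>2 A = emeasure lam A" if "A \<in> sets borel" for A
    using split[of "indicator A"] that by simp
  have frU: "frontier U \<subseteq> cball 0 T"
    using closure_mono[OF assms(5)] T_pos by (auto simp: frontier_def)
  have [simp]: "space \<mu>\<^sub>1 = UNIV" "space \<mu>\<^sub>2 = UNIV" "space \<nu>\<^sub>2 = UNIV"
    using sets_eq_imp_space_eq[of \<mu>\<^sub>1 borel] sets_eq_imp_space_eq[of \<mu>\<^sub>2 borel]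
      sets_eq_imp_space_eq[of \<nu>\<^sub>2 borel] by simp_all
  have aeF: "AE z in \<nu>\<^sub>2. z \<in> frontier U"
    using AE_iff_null_sets[of "- frontier U" \<nu>\<^sub>2] bal(2) by (simp add: null_sets_def borel_comp)
  have aeU: "AE z in \<mu>\<^sub>2. z \<in> U"
    unfolding \<mu>2 by (subst AE_density) (auto simp: indicator_def)
  have mass: "emeasure \<nu>\<^sub>2 UNIV = emeasure \<mu>\<^sub>2 UNIV"
  proof -
    have "emeasure \<nu>\<^sub>2 UNIV = emeasure \<nu>\<^sub>2 (frontier U)"
      using aeF by (intro emeasure_eq_AE) auto
    also have "\<dots> = emeasure \<mu>\<^sub>2 UNIV"
      unfolding bal(3) using aeU by (intro emeasure_eq_AE) auto
    finally show ?thesis .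
  qed
  have fin: "emeasure \<mu>\<^sub>1 UNIV < \<infinity>" "emeasure \<mu>\<^sub>2 UNIV < \<infinity>"
    using em[of UNIV] emeasure_lam_UNIV by (auto simp: less_top[symmetric])
  have disc: "disc_measure T \<mu>\<^sub>1" "disc_measure T \<mu>\<^sub>2" "disc_measure T \<nu>\<^sub>2"
  proof -
    have "AE z in \<mu>\<^sub>1. cmod z \<le> T"
      unfolding \<mu>1 by (subst AE_density) (auto simp: indicator_def)
    then show "disc_measure T \<mu>\<^sub>1" using fin by (auto simp: disc_measure_def intro!: finite_measureI)
    have "AE z in \<mu>\<^sub>2. cmod z \<le> T" using aeU by eventually_elim (use assms(5) in auto)
    then show "disc_measure T \<mu>\<^sub>2" using fin by (auto simp: disc_measure_def intro!: finite_measureI)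
    have "AE z in \<nu>\<^sub>2. cmod z \<le> T" using aeF by eventually_elim (use frU in auto)
    then show "disc_measure T \<nu>\<^sub>2" using fin mass by (auto simp: disc_measure_def intro!: finite_measureI)
  qed
  obtain N where N: "N \<in> sets borel" "polar N" "\<And>z. z \<notin> U \<Longrightarrow> z \<notin> N \<Longrightarrow> potential \<nu>\<^sub>2 z = potential \<mu>\<^sub>2 z"
    using bal(5) by (auto simp: quasi_everywhere_def)
  define \<nu> where "\<nu> = add_measure \<mu>\<^sub>1 \<nu>\<^sub>2"
  have [simp, measurable_cong]: "sets \<nu> = sets borel" and [simp]: "space \<nu> = UNIV" by (simp_all add: \<nu>_def)
  have em\<nu>: "emeasure \<nu> A = emeasure \<mu>\<^sub>1 A + emeasure \<nu>\<^sub>2 A" if "A \<in> sets borel" for A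
    unfolding \<nu>_def using that by (intro emeasure_add_measure) auto
  have nn\<nu>: "(\<integral>\<^sup>+z. f z \<partial>\<nu>) = (\<integral>\<^sup>+z. f z \<partial>\<mu>\<^sub>1) + (\<integral>\<^sup>+z. f z \<partial>\<nu>\<^sub>2)" if "f \<in> borel_measurable borel" for f
    unfolding \<nu>_def using that by (intro nn_integral_add_measure) (auto cong: measurable_cong_sets)
  have prob: "prob_space \<nu>"
    using em[of UNIV] emeasure_lam_UNIV mass by (intro prob_spaceI) (simp add: em\<nu>)
  interpret C: equilibrium_candidate g T U \<nu> N
  proof (intro equilibrium_candidate.intro equilibrium_candidate_axioms.intro)
    show "admissible_field g T" by (rule admissible_field_axioms)
    show "prob_space \<nu>" by (rule prob)
    show "open U" by fact
    show N': "N \<in> sets borel" "polar N" by fact+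
    have "finite_measure \<nu>" using prob by (simp add: prob_space_def)
    moreover have "AE z in \<nu>. cmod z \<le> T"
    proof -
      have "emeasure \<nu> (- cball 0 T) = 0"
        using disc(1,3) AE_iff_null_sets[of "- cball 0 T" \<mu>\<^sub>1] AE_iff_null_sets[of "- cball 0 T" \<nu>\<^sub>2]
        by (simp add: em\<nu> disc_measure_def null_sets_def)
      then show ?thesis using AE_iff_null_sets[of "- cball 0 T" \<nu>] by (simp add: null_sets_def)
    qed
    ultimately show "disc_measure T \<nu>" by (simp add: disc_measure_def)
    have "emeasure \<mu>\<^sub>1 U = 0"
    proof -
      have "AE z in \<mu>\<^sub>1. z \<notin> U" unfolding \<mu>1 by (subst AE_density) (auto simp: indicator_def)
      then show ?thesis using AE_iff_null_sets[of U \<mu>\<^sub>1] by (simp add: null_sets_def)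
    qed
    moreover have "emeasure \<nu>\<^sub>2 U = 0"
    proof -
      have "AE z in \<nu>\<^sub>2. z \<notin> U" using aeF by eventually_elim (use \<open>open U\<close> in \<open>auto simp: frontier_def interior_open\<close>)
      then show ?thesis using AE_iff_null_sets[of U \<nu>\<^sub>2] by (simp add: null_sets_def)
    qed
    ultimately show "emeasure \<nu> U = 0" by (simp add: em\<nu>)
    show "emeasure \<nu> B = 0" if "B \<in> sets borel" "polar B" for B
      using em[OF that(1)] lam_polar_null[OF that] bal(4)[OF that] that by (simp add: em\<nu>)
    fix z R M assume z: "z \<notin> U" "z \<notin> N" "T \<le> R" "2 * R \<le> M" "1 \<le> M" "cmod z \<le> R"
    have D: "disc_measure R \<mu>\<^sub>2" "disc_measure R \<nu>\<^sub>2" using disc z disc_measure_mono by blast+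
    \<comment> \<open>The two masses agree, so equality of the potentials carries over to the kernel \<open>log (M/|z - w|)\<close>.\<close>
    have "measure \<nu>\<^sub>2 UNIV = measure \<mu>\<^sub>2 UNIV" by (simp add: measure_def mass)
    then have "enn2ereal (log_pot M \<nu>\<^sub>2 z) - ereal c = enn2ereal (log_pot M \<mu>\<^sub>2 z) - ereal c" if "c = ln M * measure \<mu>\<^sub>2 UNIV" for c
      using N(3)[OF z(1,2)] potential_eq[OF D(1) z(4,5,6)] potential_eq[OF D(2) z(4,5,6)] that by simp
    then have "log_pot M \<nu>\<^sub>2 z = log_pot M \<mu>\<^sub>2 z"
      by (cases "log_pot M \<nu>\<^sub>2 z"; cases "log_pot M \<mu>\<^sub>2 z") (auto simp: enn2ereal_ennreal)
    then have "log_pot M \<nu> z = log_pot M \<mu>\<^sub>1 z + log_pot M \<mu>\<^sub>2 z"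
      by (simp add: log_pot_def nn\<nu>)
    also have "\<dots> = log_pot M lam z"
      unfolding log_pot_def by (rule split) measurable
    finally show "log_pot M \<nu> z = log_pot M lam z" .
  qed
  \<comment> \<open>The case of the empty set: any Borel polar set may serve as exceptional set.\<close>
  interpret C0: equilibrium_candidate g T "{}" lam "{0}"
    by (intro equilibrium_candidate.intro equilibrium_candidate_axioms.intro)
      (simp_all add: admissible_field_axioms prob_space_lam disc_measure_lam lam_polar_null polar_singleton)
  have j: "field_int \<nu> = field_int \<mu>\<^sub>1 + field_int \<nu>\<^sub>2" "field_int lam = field_int \<mu>\<^sub>1 + field_int \<mu>\<^sub>2"
    unfolding field_int_def by (rule nn\<nu>, measurable) (rule split[symmetric], measurable)
  have L1: "(LINT z:frontier U|\<nu>\<^sub>2. g (cmod z)) = enn2real (field_int \<nu>\<^sub>2)"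
  proof -
    have "(LINT z:frontier U|\<nu>\<^sub>2. g (cmod z)) = (LINT z|\<nu>\<^sub>2. g (cmod z))"
      unfolding set_lebesgue_integral_def
      by (rule integral_cong_AE, measurable) (use aeF in eventually_elim, simp)
    then show ?thesis by (simp add: integral_eq_nn_integral g_nonneg field_int_def)
  qed
  have L2: "(LINT z:U|\<mu>\<^sub>2. g (cmod z)) = enn2real (field_int \<mu>\<^sub>2)"
  proof -
    have "(LINT z:U|\<mu>\<^sub>2. g (cmod z)) = (LINT z|\<mu>\<^sub>2. g (cmod z))"
      unfolding set_lebesgue_integral_def
      by (rule integral_cong_AE, measurable) (use aeU in eventually_elim, simp)
    then show ?thesis by (simp add: integral_eq_nn_integral g_nonneg field_int_def)
  qed
  have "enn2real (field_int \<nu>) = enn2real (field_int \<mu>\<^sub>1) + enn2real (field_int \<nu>\<^sub>2)"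
    "enn2real (field_int lam) = enn2real (field_int \<mu>\<^sub>1) + enn2real (field_int \<mu>\<^sub>2)"
    unfolding j using field_int_finite[OF disc(1)] field_int_finite[OF disc(2)] field_int_finite[OF disc(3)]
    by (simp_all add: enn2real_plus)
  then have "min_energy g U = min_energy g {} +
      ereal (1 / 2 * ((LINT z:frontier U|\<nu>\<^sub>2. g (cmod z)) - (LINT z:U|\<mu>\<^sub>2. g (cmod z))))"
    unfolding C.min_energy_eq C0.min_energy_eq L1 L2 by (simp add: field_simps)
  then show ?thesis using C.is_equilibrium by (simp add: \<nu>_def)
qed

end
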